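(* Let $l,n\ge 0$ be integers and $\lambda,\mu\in\mathbb{R}$. The action $X\mapsto\mathcal{L}^{\lambda\mu}_X$ of $\mathcal{K}(2l+1|n)$ on differential operators preserves the canonical filtration, the Heisenberg filtration and the bifiltration: for every $X\in\mathcal{K}(2l+1|n)$, $k\in\mathbb{N}$ and $d\in\frac12\mathbb{N}$, $$\mathcal{L}^{\lambda\mu}_X\big(\mathcal{D}^k_{\lambda\mu}(\mathbb{R}^{2l+1|n})\big)\subseteq\mathcal{D}^k_{\lambda\mu}(\mathbb{R}^{2l+1|n}),\quad \mathcal{L}^{\lambda\mu}_X\big(\mathcal{H}^d_{\lambda\mu}(\mathbb{R}^{2l+1|n})\big)\subseteq\mathcal{H}^d_{\lambda\mu}(\mathbb{R}^{2l+1|n}),\quad \mathcal{L}^{\lambda\mu}_X\big(\mathcal{D}^{k,d}_{\lambda\mu}(\mathbb{R}^{2l+1|n})\big)\subseteq\mathcal{D}^{k,d}_{\lambda\mu}(\mathbb{R}^{2l+1|n}).$$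
   Context: Coordinates on the supermanifold $\mathbb{R}^{2l+1|n}$: even coordinates $z,x_1,\dots,x_l,y_1,\dots,y_l$ and odd coordinates $\theta_1,\dots,\theta_n$; collectively $q^0=z$, $q^r=x_r$ ($1\le r\le l$), $q^r=y_{r-l}$ ($l+1\le r\le 2l$), $q^r=\theta_{r-2l}$ ($2l+1\le r\le 2l+n$). A tilde denotes parity. Formulas with parity signs are stated for homogeneous elements and extended by linearity. Contact structure: the standard contact form is $\alpha=dz+\sum_{i=1}^l(x_i\,dy_i-y_i\,dx_i)+\sum_{j=1}^n\theta_j\,d\theta_j$. Its kernel is spanned over superfunctions by $T_r=\partial_{x_r}+y_r\partial_z$ ($1\le r\le l$), $T_r=\partial_{y_{r-l}}-x_{r-l}\partial_z$ ($l+1\le r\le 2l$), $T_r=\partial_{\theta_{r-2l}}-\theta_{r-2l}\partial_z$ ($2l+1\le r\le 2l+n$). Let $(\omega^{rs})_{1\le r,s\le 2l+n}$ be the block matrix $\begin{pmatrix}0&-\mathrm{id}_l&0\\ \mathrm{id}_l&0&0\\0&0&\mathrm{id}_n\end{pmatrix}$. Contact vector fields: $\mathcal{K}(2l+1|n)$ is the Lie superalgebra consisting of the vector fields $X_f=f\partial_z-\frac12(-1)^{\tilde f\,\tilde T_r}\omega^{rs}T_r(f)T_s$, $f\in C^\infty(\mathbb{R}^{2l+1|n})$ (repeated indices are summed over $1,\dots,2l+n$). Write $f'=\partial_zf$. For $\lambda\in\mathbb{R}$, $\mathcal{F}_\lambda(\mathbb{R}^{2l+1|n})$ is the space $C^\infty(\mathbb{R}^{2l+1|n})$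 (elements written $g\alpha^\lambda$) with the action $L^\lambda_{X_f}(g)=X_f(g)+\lambda f'g$. Differential operators: $\mathcal{D}^k_{\lambda\mu}(\mathbb{R}^{2l+1|n})$ is the space of differential operators of order (at most) $k$ from $\mathcal{F}_\lambda(\mathbb{R}^{2l+1|n})$ to $\mathcal{F}_\mu(\mathbb{R}^{2l+1|n})$, i.e. maps $g\alpha^\lambda\mapsto\big(\sum_{|I|\le k}D_I\,\partial_{q^I}g\big)\alpha^\mu$ with superfunction coefficients $D_I$, where $I=(i_0,\dots,i_{2l+n})$, $|I|=\sum_A i_A$, $\partial_{q^I}=\partial_{q^0}^{i_0}\cdots\partial_{q^{2l+n}}^{i_{2l+n}}$ and the exponents of odd derivatives are at most $1$. Set $\mathcal{D}_{\lambda\mu}=\bigcup_k\mathcal{D}^k_{\lambda\mu}$. The action of $X\in\mathcal{K}(2l+1|n)$ is $\mathcal{L}^{\lambda\mu}_XD=L^\mu_X\circ D-(-1)^{\tilde X\tilde D}D\circ L^\lambda_X$. Heisenberg filtration: every differential operator can be written uniquely as $D=\sum_{c,K}D_{cK}\,\partial_z^cT^K$ (a finite sum), with superfunctions $D_{cK}$, $c\in\mathbb{N}$, $K=(i_1,\dots,i_{2l+n})$, $T^K=T_1^{i_1}\cdots T_{2l+n}^{i_{2l+n}}$, exponents of the odd fields $T_{2l+1},\dots,T_{2l+n}$ at most $1$, and $|K|=i_1+\dots+i_{2l+n}$. For $d\in\frac12\mathbb{N}$, $\mathcal{H}^d_{\lambda\mu}(\mathbb{R}^{2l+1|n})$ is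 the space of those $D\in\mathcal{D}_{\lambda\mu}$ for which $c+\frac12|K|\le d$ for all $c,K$ occurring in this expression (Heisenberg order $d$). The union of these spaces, viewed with this filtration, is denoted $\mathcal{H}_{\lambda\mu}$. Bifiltration: $\mathcal{D}^{k,d}_{\lambda\mu}(\mathbb{R}^{2l+1|n})=\mathcal{D}^k_{\lambda\mu}(\mathbb{R}^{2l+1|n})\cap\mathcal{H}^d_{\lambda\mu}(\mathbb{R}^{2l+1|n})$. *)

theory Defs
  imports "HOL-Analysis.Analysis" "HOL-Library.Function_Algebras"
begin

text \<open>
  Since \<open>l\<close> and \<open>n\<close> are arbitrary natural numbers (possibly \<open>0\<close>), points of
  \<open>\<real>\<^bsup>2l+1\<^esup>\<close> are represented by \<open>p :: nat \<Rightarrow> real\<close> with \<open>p r = q\<^sup>r\<close> for \<open>r \<le> 2l\<close>, and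
  functions on \<open>\<real>\<^bsup>2l+1\<^esup>\<close> by functions of \<open>p\<close> that only depend on these coordinates.
  For such functions, continuity in the product topology of \<open>nat \<Rightarrow> real\<close> is
  continuity on Euclidean space.
\<close>

definition partial :: "nat \<Rightarrow> ((nat \<Rightarrow> real) \<Rightarrow> real) \<Rightarrow> (nat \<Rightarrow> real) \<Rightarrow> real" where
  "partial i \<phi> p = deriv (\<lambda>t. \<phi> (p(i := t))) (p i)"

text \<open>\<open>C\<^sup>\<infinity>\<close>: all iterated partial derivatives exist and are continuous.\<close>

definition smooth :: "nat \<Rightarrow> ((nat \<Rightarrow> real) \<Rightarrow> real) \<Rightarrow> bool" where
  "smooth m \<phi> \<longleftrightarrow>
     (\<forall>p p'. (\<forall>i<m. p i = p' i) \<longrightarrow> \<phi> p = \<phi> p') \<and>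
     (\<forall>is. set is \<subseteq> {..<m} \<longrightarrow>
        continuous_on UNIV (foldr partial is \<phi>) \<and>
        (\<forall>i<m. \<forall>p. (\<lambda>t. foldr partial is \<phi> (p(i := t))) differentiable (at (p i))))"

text \<open>
  A superfunction \<open>f = \<Sum>\<^sub>J f\<^sub>J \<theta>\<^sub>J\<close> is given by its components \<open>f J\<close>, where
  \<open>J \<subseteq> {1..n}\<close> and \<open>\<theta>\<^sub>J\<close> is the product of the \<open>\<theta>\<^sub>j\<close>, \<open>j \<in> J\<close>, in increasing order.
  Sums and differences of superfunctions are the pointwise ones of
  \<^theory>\<open>HOL-Library.Function_Algebras\<close>; the supercommutative product is \<open>\<odot>\<close>.
\<close>

type_synonym sfun = "nat set \<Rightarrow> (nat \<Rightarrow> real) \<Rightarrow> real"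

definition superfunctions :: "nat \<Rightarrow> nat \<Rightarrow> sfun set" where
  "superfunctions l n =
     {f. \<forall>J. if J \<subseteq> {1..n} then smooth (2 * l + 1) (f J) else f J = 0}"

definition sscale :: "real \<Rightarrow> sfun \<Rightarrow> sfun" where
  "sscale c f = (\<lambda>J p. c * f J p)"

text \<open>The sign is that of \<open>\<theta>\<^sub>K \<theta>\<^bsub>J - K\<^esub> = \<plusminus>\<theta>\<^sub>J\<close>.\<close>

definition smult :: "sfun \<Rightarrow> sfun \<Rightarrow> sfun" (infixl "\<odot>" 70) where
  "f \<odot> g = (\<lambda>J p. \<Sum>K\<in>Pow J.
      (-1) ^ card {(a, b). a \<in> K \<and> b \<in> J - K \<and> b < a} * f K p * g (J - K) p)"

text \<open>Homogeneous component of parity \<open>a \<in> {0, 1}\<close>.\<close>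

definition spart :: "nat \<Rightarrow> sfun \<Rightarrow> sfun" where
  "spart a f = (\<lambda>J. if card J mod 2 = a then f J else 0)"

text \<open>
  Coordinates \<open>q\<^sup>A\<close> and coordinate derivatives \<open>\<partial>/\<partial>q\<^sup>A\<close>, \<open>0 \<le> A \<le> 2l + n\<close>
  (left derivatives for odd coordinates).
\<close>

definition coord :: "nat \<Rightarrow> nat \<Rightarrow> sfun" where
  "coord l A = (\<lambda>J p. if A \<le> 2 * l then (if J = {} then p A else 0)
                      else (if J = {A - 2 * l} then 1 else 0))"

definition dq :: "nat \<Rightarrow> nat \<Rightarrow> sfun \<Rightarrow> sfun" where
  "dq l A f = (if A \<le> 2 * l then (\<lambda>J. partial A (f J))
     else (\<lambda>J p. if A - 2 * l \<in> J then 0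
                 else (-1) ^ card {a \<in> J. a < A - 2 * l} * f (insert (A - 2 * l) J) p))"

text \<open>Parity of \<open>q\<^sup>r\<close>, hence of \<open>T\<^sub>r\<close>.\<close>

definition par :: "nat \<Rightarrow> nat \<Rightarrow> nat" where
  "par l r = (if r \<le> 2 * l then 0 else 1)"

text \<open>The fields \<open>T\<^sub>r\<close>, \<open>1 \<le> r \<le> 2l + n\<close>, spanning the contact distribution.\<close>

definition Tvf :: "nat \<Rightarrow> nat \<Rightarrow> sfun \<Rightarrow> sfun" where
  "Tvf l r f =
     (if r \<le> l then dq l r f + coord l (l + r) \<odot> dq l 0 f
      else if r \<le> 2 * l then dq l r f - coord l (r - l) \<odot> dq l 0 f
      else dq l r f - coord l r \<odot> dq l 0 f)"

text \<open>Only used for \<open>1 \<le> r, s \<le> 2l + n\<close>.\<close>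

definition omega :: "nat \<Rightarrow> nat \<Rightarrow> nat \<Rightarrow> real" where
  "omega l r s =
     (if r \<le> l \<and> s = l + r then -1
      else if r \<le> 2 * l \<and> r = l + s then 1
      else if 2 * l < r \<and> r = s then 1
      else 0)"

text \<open>
  The contact vector field \<open>X\<^sub>f\<close>, as an operator on superfunctions: first for \<open>f\<close>
  homogeneous of parity \<open>a\<close>, then extended linearly in \<open>f\<close>. The Lie superalgebra
  \<open>\<K>(2l+1|n)\<close> consists of the \<open>X\<^sub>f\<close> with \<open>f \<in> superfunctions l n\<close>, and \<open>X\<^sub>f\<close> has the
  parity of \<open>f\<close>.
\<close>

definition contact_field_hom :: "nat \<Rightarrow> nat \<Rightarrow> nat \<Rightarrow> sfun \<Rightarrow> sfun \<Rightarrow> sfun" where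
  "contact_field_hom l n a f g =
     f \<odot> dq l 0 g - sscale (1/2)
       (\<Sum>r\<in>{1..2*l+n}. \<Sum>s\<in>{1..2*l+n}.
          sscale ((-1) ^ (a * par l r) * omega l r s) (Tvf l r f \<odot> Tvf l s g))"

definition contact_field :: "nat \<Rightarrow> nat \<Rightarrow> sfun \<Rightarrow> sfun \<Rightarrow> sfun" where
  "contact_field l n f g = (\<Sum>a\<in>{0,1}. contact_field_hom l n a (spart a f) g)"

text \<open>\<open>L\<^sup>\<lambda>\<close> for \<open>X\<^sub>f\<close>; the density \<open>g \<alpha>\<^sup>\<lambda>\<close> is identified with \<open>g\<close>.\<close>

definition Lie_density :: "nat \<Rightarrow> nat \<Rightarrow> real \<Rightarrow> sfun \<Rightarrow> sfun \<Rightarrow> sfun" where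
  "Lie_density l n lam f g = contact_field l n f g + sscale lam (dq l 0 f \<odot> g)"

text \<open>Homogeneous component of parity \<open>b\<close> of a linear operator.\<close>

definition opart :: "nat \<Rightarrow> (sfun \<Rightarrow> sfun) \<Rightarrow> sfun \<Rightarrow> sfun" where
  "opart b D g = (\<Sum>a\<in>{0,1}. spart ((a + b) mod 2) (D (spart a g)))"

text \<open>The supercommutator \<open>L\<^sup>\<mu> \<circ> D - (-1)\<^sup>a\<^sup>b D \<circ> L\<^sup>\<lambda>\<close> along \<open>X\<^sub>f\<close>, extended bilinearly.\<close>

definition Lie_op ::
    "nat \<Rightarrow> nat \<Rightarrow> real \<Rightarrow> real \<Rightarrow> sfun \<Rightarrow> (sfun \<Rightarrow> sfun) \<Rightarrow> sfun \<Rightarrow> sfun" where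
  "Lie_op l n lam mu f D g = (\<Sum>a\<in>{0,1}. \<Sum>b\<in>{0,1}.
      Lie_density l n mu (spart a f) (opart b D g)
      - sscale ((-1) ^ (a * b)) (opart b D (Lie_density l n lam (spart a f) g)))"

text \<open>
  Differential operators are maps on superfunctions; the values of a representative
  \<open>D :: sfun \<Rightarrow> sfun\<close> outside \<open>superfunctions l n\<close> are irrelevant. As sets of maps
  \<open>g \<mapsto> D g\<close> (densities being identified with superfunctions) the spaces for
  different weights \<open>\<lambda>, \<mu>\<close> coincide; the weights only enter the action \<open>Lie_op\<close>.
\<close>

definition multi_indices :: "nat \<Rightarrow> nat \<Rightarrow> (nat \<Rightarrow> nat) set" where
  "multi_indices l n =
     {I. (\<forall>A. 2 * l < A \<longrightarrow> I A \<le> 1) \<and> (\<forall>A. 2 * l + n < A \<longrightarrow> I A = 0)}"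

definition dq_power :: "nat \<Rightarrow> nat \<Rightarrow> (nat \<Rightarrow> nat) \<Rightarrow> sfun \<Rightarrow> sfun" where
  "dq_power l n I = foldr (\<lambda>A h. (dq l A ^^ I A) \<circ> h) [0..<2 * l + n + 1] id"

definition T_power :: "nat \<Rightarrow> nat \<Rightarrow> (nat \<Rightarrow> nat) \<Rightarrow> sfun \<Rightarrow> sfun" where
  "T_power l n K = foldr (\<lambda>r h. (Tvf l r ^^ K r) \<circ> h) [1..<2 * l + n + 1] id"

definition diff_ops :: "nat \<Rightarrow> nat \<Rightarrow> nat \<Rightarrow> (sfun \<Rightarrow> sfun) set" where
  "diff_ops l n k =
     {D. \<exists>C. (\<forall>I. C I \<in> superfunctions l n) \<and>
        (\<forall>g \<in> superfunctions l n.
           D g = (\<Sum>I \<in> {I \<in> multi_indices l n. (\<Sum>A\<in>{0..2*l+n}. I A) \<le> k}.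
                    C I \<odot> dq_power l n I g))}"

text \<open>
  The expansion \<open>D = \<Sum> D\<^sub>c\<^sub>K \<partial>\<^sub>z\<^sup>c T\<^sup>K\<close> with finitely many nonzero coefficients
  \<open>E c K = D\<^sub>c\<^sub>K\<close>. The multi-index \<open>K\<close> is a member of \<open>multi_indices\<close> with \<open>K 0 = 0\<close>.
\<close>

definition heisenberg_expansion ::
    "nat \<Rightarrow> nat \<Rightarrow> (sfun \<Rightarrow> sfun) \<Rightarrow> (nat \<Rightarrow> (nat \<Rightarrow> nat) \<Rightarrow> sfun) \<Rightarrow> bool" where
  "heisenberg_expansion l n D E \<longleftrightarrow>
     (\<forall>c K. E c K \<in> superfunctions l n) \<and>
     (\<forall>c K. E c K \<noteq> 0 \<longrightarrow> K \<in> multi_indices l n \<and> K 0 = 0) \<and>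
     finite {(c, K). E c K \<noteq> 0} \<and>
     (\<forall>g \<in> superfunctions l n.
        D g = (\<Sum>(c, K) \<in> {(c, K). E c K \<noteq> 0}. E c K \<odot> (dq l 0 ^^ c) (T_power l n K g)))"

text \<open>The expansion is unique, so the existential quantifier refers to \<^emph>\<open>the\<close> expansion.\<close>

definition heisenberg_ops :: "nat \<Rightarrow> nat \<Rightarrow> real \<Rightarrow> (sfun \<Rightarrow> sfun) set" where
  "heisenberg_ops l n d =
     {D \<in> (\<Union>k. diff_ops l n k). \<exists>E. heisenberg_expansion l n D E \<and>
        (\<forall>c K. E c K \<noteq> 0 \<longrightarrow> real c + real (\<Sum>r\<in>{1..2*l+n}. K r) / 2 \<le> d)}"

definition bifiltered_ops :: "nat \<Rightarrow> nat \<Rightarrow> nat \<Rightarrow> real \<Rightarrow> (sfun \<Rightarrow> sfun) set" where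
  "bifiltered_ops l n k d = diff_ops l n k \<inter> heisenberg_ops l n d"

end

theory Submission
  imports Defs
begin

text \<open>
  Both filtrations are generated by a frame of vector fields with weights: the canonical one by the
  coordinate derivatives, all of weight \<open>1\<close>, and the Heisenberg one (with doubled orders) by
  \<open>\<partial>\<^sub>z\<close> of weight \<open>2\<close> and the \<open>T\<^sub>r\<close> of weight \<open>1\<close>. In either case the fields supercommute up to
  multiples of the field with index \<open>0\<close>, whose weight is at most the sum of the two weights. Hence the
  operators of filtration degree \<open>m\<close> are those built from the identity by sums, multiplication by
  superfunctions and composition with frame fields of total weight at most \<open>m\<close>. By induction along this
  construction, the supercommutator with \<open>X\<^sub>f\<close> preserves the degree as soon as it does so on the frame. For the
  coordinate derivatives this holds for every vector field. For \<open>\<partial>\<^sub>z\<close> it holds because \<open>X\<^sub>f\<close> has weight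
  \<open>2\<close>, and for \<open>T\<^sub>r\<close> because the \<open>\<partial>\<^sub>z\<close>-component of \<open>[X\<^sub>f, T\<^sub>r]\<close> vanishes: this is the contact
  condition.
\<close>

section \<open>Smooth functions\<close>

text \<open>Both filtrations are defined through ordered monomials, and composing with a vector
  field destroys the order. The reordering is therefore done once, in
  \<open>normal_form_word\<close>; after that, operators are followed one generator at a time by the
  Leibniz rule, and no coefficient of a supercommutator is ever written out. Only a component along
  the field with index 0 can raise a degree, since all other fields share the least weight; this
  leaves a single identity to check for each frame field. The other obstacle is the signs: neither
  the operator nor the superfunctions it acts on are homogeneous, and splitting them all would
  multiply the cases. Conjugation by the parity involution absorbs these signs, so that only the
  function defining the contact field has to be split.\<close>

lemma second_difference_mean_value:
  fixes F Fs Fts :: "real \<Rightarrow> real \<Rightarrow> real"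
  assumes Fs: "\<And>s t. ((\<lambda>s. F s t) has_real_derivative Fs s t) (at s)"
    and Fts: "\<And>s t. ((\<lambda>t. Fs s t) has_real_derivative Fts s t) (at t)"
    and h: "h > 0"
  shows "\<exists>\<xi> \<eta>. a < \<xi> \<and> \<xi> < a + h \<and> b < \<eta> \<and> \<eta> < b + h \<and>
           F (a + h) (b + h) - F (a + h) b - F a (b + h) + F a b = h * h * Fts \<xi> \<eta>"
proof -
  have "\<exists>\<xi>. a < \<xi> \<and> \<xi> < a + h \<and>
      (F (a + h) (b + h) - F (a + h) b) - (F a (b + h) - F a b)
        = (a + h - a) * (Fs \<xi> (b + h) - Fs \<xi> b)"
    using h by (intro MVT2) (auto intro!: derivative_intros Fs)
  then obtain \<xi> where \<xi>: "a < \<xi>" "\<xi> < a + h"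
      "(F (a + h) (b + h) - F (a + h) b) - (F a (b + h) - F a b) = h * (Fs \<xi> (b + h) - Fs \<xi> b)"
    by auto
  have "\<exists>\<eta>. b < \<eta> \<and> \<eta> < b + h \<and> Fs \<xi> (b + h) - Fs \<xi> b = (b + h - b) * Fts \<xi> \<eta>"
    using h by (intro MVT2) (auto intro!: derivative_intros Fts)
  then obtain \<eta> where "b < \<eta>" "\<eta> < b + h" "Fs \<xi> (b + h) - Fs \<xi> b = h * Fts \<xi> \<eta>"
    by auto
  with \<xi> show ?thesis
    by (intro exI[of _ \<xi>] exI[of _ \<eta>]) (auto simp: algebra_simps)
qed

text \<open>The second difference over a small square can be evaluated by the mean value theorem in
  either order of the variables, so both mixed derivatives take the same value somewhere in the
  square; continuity at the corner carries this to \<open>(a, b)\<close>.\<close>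

lemma mixed_derivatives_eq:
  fixes F Fs Ft Fst Fts :: "real \<Rightarrow> real \<Rightarrow> real"
  assumes Fs: "\<And>s t. ((\<lambda>s. F s t) has_real_derivative Fs s t) (at s)"
    and Ft: "\<And>s t. ((\<lambda>t. F s t) has_real_derivative Ft s t) (at t)"
    and Fts: "\<And>s t. ((\<lambda>t. Fs s t) has_real_derivative Fts s t) (at t)"
    and Fst: "\<And>s t. ((\<lambda>s. Ft s t) has_real_derivative Fst s t) (at s)"
    and c1: "isCont (\<lambda>z. Fst (fst z) (snd z)) (a, b)"
    and c2: "isCont (\<lambda>z. Fts (fst z) (snd z)) (a, b)"
  shows "Fst a b = Fts a b"
proof (rule ccontr)
  assume ne: "Fst a b \<noteq> Fts a b"
  \<comment> \<open>Half the gap: no number is within \<open>e\<close> of both mixed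
    derivatives.\<close>
  define e where "e = \<bar>Fst a b - Fts a b\<bar> / 2"
  have e: "e > 0" using ne by (simp add: e_def)
  obtain d1 where d1: "d1 > 0" "\<And>z. dist z (a, b) < d1 \<Longrightarrow> dist (Fst (fst z) (snd z)) (Fst a b) < e"
    using c1 e unfolding continuous_at_eps_delta by fastforce
  obtain d2 where d2: "d2 > 0" "\<And>z. dist z (a, b) < d2 \<Longrightarrow> dist (Fts (fst z) (snd z)) (Fts a b) < e"
    using c2 e unfolding continuous_at_eps_delta by fastforce
  \<comment> \<open>The estimate \<open>near\<close> only bounds the distance by
    \<open>2 * h\<close>, hence half of the smaller radius.\<close>
  define h where "h = min d1 d2 / 2"
  have h: "h > 0" "2 * h \<le> d1" "2 * h \<le> d2" using d1 d2 by (auto simp: h_def)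
  have near: "dist (\<xi>, \<eta>) (a, b) < 2 * h"
    if "a < \<xi>" "\<xi> < a + h" "b < \<eta>" "\<eta> < b + h" for \<xi> \<eta>
  proof -
    have "dist (\<xi>, \<eta>) (a, b) \<le> dist \<xi> a + dist \<eta> b"
      unfolding dist_Pair_Pair by (rule sqrt_sum_squares_le_sum) auto
    also have "\<dots> < 2 * h" using that by (auto simp: dist_real_def)
    finally show ?thesis .
  qed
  obtain \<xi> \<eta> where 1: "a < \<xi>" "\<xi> < a + h" "b < \<eta>" "\<eta> < b + h"
      "F (a + h) (b + h) - F (a + h) b - F a (b + h) + F a b = h * h * Fts \<xi> \<eta>"
    using second_difference_mean_value[of F Fs Fts, OF Fs Fts h(1)] by metis
  obtain \<eta>' \<xi>' where 2: "b < \<eta>'" "\<eta>' < b + h" "a < \<xi>'" "\<xi>' < a + h"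
      "F (a + h) (b + h) - F a (b + h) - F (a + h) b + F a b = h * h * Fst \<xi>' \<eta>'"
    using second_difference_mean_value[of "\<lambda>t s. F s t" "\<lambda>t s. Ft s t" "\<lambda>t s. Fst s t" h b a,
        OF Ft Fst h(1)] by metis
  have "h * h * Fts \<xi> \<eta> = h * h * Fst \<xi>' \<eta>'" using 1(5) 2(5) by linarith
  then have eq: "Fts \<xi> \<eta> = Fst \<xi>' \<eta>'" using h by simp
  have "dist (Fts \<xi> \<eta>) (Fts a b) < e"
    using d2(2)[of "(\<xi>, \<eta>)"] near[OF 1(1-4)] h by simp
  moreover have "dist (Fst \<xi>' \<eta>') (Fst a b) < e"
    using d1(2)[of "(\<xi>', \<eta>')"] near[OF 2(3,4,1,2)] h by simp
  ultimately show False using eq by (auto simp: dist_real_def e_def abs_if split: if_splits)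
qed

section \<open>Smoothness and the rules for partial derivatives\<close>

lemma smooth_depends: "smooth m \<phi> \<Longrightarrow> (\<And>i. i < m \<Longrightarrow> p i = p' i) \<Longrightarrow> \<phi> p = \<phi> p'"
  unfolding smooth_def by blast

lemma smooth_continuous: "smooth m \<phi> \<Longrightarrow> continuous_on UNIV \<phi>"
  unfolding smooth_def by (metis empty_set empty_subsetI foldr.simps(1) id_apply)

lemma smooth_differentiable:
  assumes "smooth m \<phi>" "i < m"
  shows "(\<lambda>t. \<phi> (p(i := t))) differentiable (at s)"
proof -
  have "\<forall>p. (\<lambda>t. foldr partial [] \<phi> (p(i := t))) differentiable (at (p i))"
    using assms unfolding smooth_def by (metis empty_set empty_subsetI)
  from spec[OF this, of "p(i := s)"] show ?thesis by simp
qed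

lemma smooth_has_partial:
  assumes "smooth m \<phi>" "i < m"
  shows "((\<lambda>t. \<phi> (p(i := t))) has_real_derivative partial i \<phi> (p(i := s))) (at s)"
  using smooth_differentiable[OF assms, of p s]
  by (simp add: partial_def DERIV_deriv_iff_real_differentiable)

lemma partial_eqI:
  assumes "((\<lambda>t. \<phi> (p(i := t))) has_real_derivative D) (at (p i))"
  shows "partial i \<phi> p = D"
  unfolding partial_def by (rule DERIV_imp_deriv[OF assms])

lemma smooth_partial:
  assumes "smooth m \<phi>" "i < m"
  shows "smooth m (partial i \<phi>)"
  unfolding smooth_def
proof (intro conjI allI impI)
  fix p p' :: "nat \<Rightarrow> real" assume *: "\<forall>j<m. p j = p' j"
  have "(\<lambda>t. \<phi> (p(i := t))) = (\<lambda>t. \<phi> (p'(i := t)))"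
    by (rule ext, rule smooth_depends[OF assms(1)]) (use * in auto)
  then show "partial i \<phi> p = partial i \<phi> p'"
    using * assms(2) by (simp add: partial_def)
next
  fix "is" :: "nat list" assume "set is \<subseteq> {..<m}"
  then have s: "set (is @ [i]) \<subseteq> {..<m}" using assms(2) by auto
  have "continuous_on UNIV (foldr partial (is @ [i]) \<phi>)"
    using assms(1) s unfolding smooth_def by blast
  then show "continuous_on UNIV (foldr partial is (partial i \<phi>))" by simp
  fix j p assume j: "j < m"
  have "(\<lambda>t. foldr partial (is @ [i]) \<phi> (p(j := t))) differentiable (at (p j))"
    using assms(1) s j unfolding smooth_def by blast
  then show "(\<lambda>t. foldr partial is (partial i \<phi>) (p(j := t))) differentiable (at (p j))" by simp
qed

text \<open>Iterated partial derivatives need no explicit form: it suffices to place \<phi> in a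
  class that is stable under one partial derivative and whose members have the properties of order
  zero and one.\<close>

lemma smooth_coinduct:
  assumes "\<phi> \<in> P"
    and dep: "\<And>\<phi> p p'. \<phi> \<in> P \<Longrightarrow> (\<And>i. i < m \<Longrightarrow> p i = p' i) \<Longrightarrow> \<phi> p = \<phi> p'"
    and cont: "\<And>\<phi>. \<phi> \<in> P \<Longrightarrow> continuous_on UNIV \<phi>"
    and diff: "\<And>\<phi> i p. \<phi> \<in> P \<Longrightarrow> i < m \<Longrightarrow> (\<lambda>t. \<phi> (p(i := t))) differentiable (at (p i))"
    and closed: "\<And>\<phi> i. \<phi> \<in> P \<Longrightarrow> i < m \<Longrightarrow> partial i \<phi> \<in> P"
  shows "smooth m \<phi>"
proof -
  have *: "foldr partial is \<phi> \<in> P" if "set is \<subseteq> {..<m}" for "is"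
    using that by (induction "is") (auto simp: assms(1) closed)
  show ?thesis unfolding smooth_def using * dep[OF assms(1)] cont diff by blast
qed

text \<open>Products alone are not stable under \<open>partial\<close>, because the product rule
  yields a sum of two of them; sums of products are, so \<open>smooth_coinduct\<close> applies to
  this class.\<close>

inductive_set product_span :: "nat \<Rightarrow> ((nat \<Rightarrow> real) \<Rightarrow> real) set" for m where
  product: "smooth m \<phi> \<Longrightarrow> smooth m \<psi> \<Longrightarrow> (\<lambda>p. \<phi> p * \<psi> p) \<in> product_span m"
| sum: "\<phi> \<in> product_span m \<Longrightarrow> \<psi> \<in> product_span m \<Longrightarrow> (\<lambda>p. \<phi> p + \<psi> p) \<in> product_span m"

lemma partial_mult:
  assumes "smooth m \<phi>" "smooth m \<psi>" "i < m"
  shows "partial i (\<lambda>p. \<phi> p * \<psi> p) = (\<lambda>p. partial i \<phi> p * \<psi> p + \<phi> p * partial i \<psi> p)"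
proof
  fix p
  show "partial i (\<lambda>p. \<phi> p * \<psi> p) p = partial i \<phi> p * \<psi> p + \<phi> p * partial i \<psi> p"
    using DERIV_mult[OF smooth_has_partial[OF assms(1,3), of p "p i"]
        smooth_has_partial[OF assms(2,3), of p "p i"]]
    by (intro partial_eqI) (simp add: algebra_simps)
qed

lemma partial_add_differentiable:
  assumes "\<And>p. (\<lambda>t. \<phi> (p(i := t))) differentiable (at (p i))"
    and "\<And>p. (\<lambda>t. \<psi> (p(i := t))) differentiable (at (p i))"
  shows "partial i (\<lambda>p. \<phi> p + \<psi> p) = (\<lambda>p. partial i \<phi> p + partial i \<psi> p)"
proof
  fix p
  have "((\<lambda>t. \<phi> (p(i := t))) has_real_derivative partial i \<phi> p) (at (p i))"
    "((\<lambda>t. \<psi> (p(i := t))) has_real_derivative partial i \<psi> p) (at (p i))"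
    using assms[of p] by (simp_all add: partial_def DERIV_deriv_iff_real_differentiable)
  then show "partial i (\<lambda>p. \<phi> p + \<psi> p) p = partial i \<phi> p + partial i \<psi> p"
    by (intro partial_eqI DERIV_add)
qed

lemma product_span_differentiable:
  assumes "\<phi> \<in> product_span m" "i < m"
  shows "(\<lambda>t. \<phi> (p(i := t))) differentiable (at (p i))"
  using assms
proof induction
  case (product \<phi> \<psi>)
  show ?case
    by (intro differentiable_mult smooth_differentiable[of m] product)
next
  case (sum \<phi> \<psi>)
  then show ?case by (intro differentiable_add) auto
qed

lemma product_span_smooth:
  assumes "\<phi> \<in> product_span m"
  shows "smooth m \<phi>"
  using assms
proof (rule smooth_coinduct[where P = "product_span m"])
  fix \<phi> and p p' :: "nat \<Rightarrow> real"
  assume "\<phi> \<in> product_span m" and *: "\<And>i. i < m \<Longrightarrow> p i = p' i"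
  then show "\<phi> p = \<phi> p'"
    by (induction) (use smooth_depends[of m _ p p'] * in \<open>auto intro: arg_cong2[where f = "(*)"]\<close>)
next
  fix \<phi> assume "\<phi> \<in> product_span m"
  then show "continuous_on UNIV \<phi>"
    by (induction) (auto intro!: continuous_on_mult continuous_on_add dest: smooth_continuous)
next
  fix \<phi> i assume "\<phi> \<in> product_span m" and i: "i < m"
  then show "partial i \<phi> \<in> product_span m"
  proof induction
    case (product \<phi> \<psi>)
    then show ?case
      by (simp add: partial_mult[OF _ _ i] product_span.intros smooth_partial i)
  next
    case (sum \<phi> \<psi>)
    then show ?case
      by (simp add: partial_add_differentiable product_span_differentiable i product_span.sum)
  qed
qed (use product_span_differentiable in blast)

lemma smooth_mult: "smooth m \<phi> \<Longrightarrow> smooth m \<psi> \<Longrightarrow> smooth m (\<lambda>p. \<phi> p * \<psi> p)"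
  by (simp add: product_span.product product_span_smooth)

lemma partial_const [simp]: "partial i (\<lambda>p. c) = (\<lambda>p. 0)"
  by (simp add: partial_def fun_eq_iff)

lemma smooth_const: "smooth m (\<lambda>p. c)"
  by (rule smooth_coinduct[where P = "range (\<lambda>c p. c)"]) auto

lemma partial_zero [simp]: "partial i 0 = 0"
  unfolding zero_fun_def by (rule partial_const)

lemma smooth_zero: "smooth m 0"
  unfolding zero_fun_def by (rule smooth_const)

lemma smooth_cmult: "smooth m \<phi> \<Longrightarrow> smooth m (\<lambda>p. c * \<phi> p)"
  by (rule smooth_mult[OF smooth_const])

text \<open>Both summands lie in \<open>product_span\<close> as products with the constant 1, so the
  same class also settles sums.\<close>

lemma smooth_add:
  assumes "smooth m \<phi>" "smooth m \<psi>" shows "smooth m (\<lambda>p. \<phi> p + \<psi> p)"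
  using product_span_smooth[OF product_span.sum[OF product_span.product[OF smooth_const[of m 1] assms(1)]
        product_span.product[OF smooth_const[of m 1] assms(2)]]] by simp

lemma smooth_sum: "(\<And>x. x \<in> A \<Longrightarrow> smooth m (\<phi> x)) \<Longrightarrow> smooth m (\<lambda>p. \<Sum>x\<in>A. \<phi> x p)"
  by (induction A rule: infinite_finite_induct) (auto simp: smooth_const smooth_add)

lemma partial_coordinate: "partial i (\<lambda>p. p j) = (\<lambda>p. if i = j then 1 else 0)"
  by (auto simp: fun_eq_iff partial_def)

lemma smooth_coordinate: "j < m \<Longrightarrow> smooth m (\<lambda>p. p j)"
proof (rule smooth_coinduct[where P = "insert (\<lambda>p. p j) (range (\<lambda>c p. c))"])
  fix \<phi> :: "(nat \<Rightarrow> real) \<Rightarrow> real" and i and p :: "nat \<Rightarrow> real"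
  assume "\<phi> \<in> insert (\<lambda>p. p j) (range (\<lambda>c p. c))"
  then show "(\<lambda>t. \<phi> (p(i := t))) differentiable (at (p i))"
    by (cases "i = j") auto
qed (auto simp: partial_coordinate)

lemma partial_add:
  assumes "smooth m \<phi>" "smooth m \<psi>" "i < m"
  shows "partial i (\<lambda>p. \<phi> p + \<psi> p) = (\<lambda>p. partial i \<phi> p + partial i \<psi> p)"
  using assms by (intro partial_add_differentiable smooth_differentiable)

lemma partial_cmult:
  assumes "smooth m \<phi>" "i < m"
  shows "partial i (\<lambda>p. c * \<phi> p) = (\<lambda>p. c * partial i \<phi> p)"
  using partial_mult[OF smooth_const[of m c] assms] by (simp add: fun_eq_iff)

lemma partial_sum:
  assumes "\<And>x. x \<in> A \<Longrightarrow> smooth m (\<phi> x)" "i < m"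
  shows "partial i (\<lambda>p. \<Sum>x\<in>A. \<phi> x p) = (\<lambda>p. \<Sum>x\<in>A. partial i (\<phi> x) p)"
  using assms(1)
proof (induction A rule: infinite_finite_induct)
  case (insert x A)
  then show ?case by (simp add: partial_add[OF _ smooth_sum assms(2)])
qed auto

lemma partial_commute:
  assumes "smooth m \<phi>" "i < m" "j < m"
  shows "partial i (partial j \<phi>) = partial j (partial i \<phi>)"
proof (cases "i = j")
  case False
  show ?thesis
  proof
    fix p :: "nat \<Rightarrow> real"
    \<comment> \<open>Freezing all coordinates but \<open>i\<close> and \<open>j\<close> reduces the
      claim to \<open>mixed_derivatives_eq\<close>. As \<open>i\<close> and \<open>j\<close> differ,
      either update may be performed last, which exhibits each of the two one-variable
      derivatives.\<close>
    define P where "P s t = p(i := s, j := t)" for s t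
    have P': "P s t = p(j := t, i := s)" for s t
      using False by (simp add: P_def fun_upd_twist)
    have di: "((\<lambda>s. \<psi> (P s t)) has_real_derivative partial i \<psi> (P s t)) (at s)"
      if "smooth m \<psi>" for \<psi> s t
      unfolding P' by (rule smooth_has_partial[OF that assms(2)])
    have dj: "((\<lambda>t. \<psi> (P s t)) has_real_derivative partial j \<psi> (P s t)) (at t)"
      if "smooth m \<psi>" for \<psi> s t
      unfolding P_def by (rule smooth_has_partial[OF that assms(3)])
    have cP: "continuous_on UNIV (\<lambda>z. P (fst z) (snd z))"
    proof (rule continuous_on_coordinatewise_then_product)
      fix k
      show "continuous_on UNIV (\<lambda>z. P (fst z) (snd z) k)"
        by (cases "k = i"; cases "k = j") (simp_all add: P_def continuous_on_fst continuous_on_snd)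
    qed
    have c: "isCont (\<lambda>z. \<psi> (P (fst z) (snd z))) (a, b)" if "smooth m \<psi>" for \<psi> a b
      using continuous_on_compose2[OF smooth_continuous[OF that] cP]
      by (simp add: continuous_on_eq_continuous_at)
    have sm: "smooth m (partial i \<phi>)" "smooth m (partial j \<phi>)"
      "smooth m (partial i (partial j \<phi>))" "smooth m (partial j (partial i \<phi>))"
      using assms by (auto intro: smooth_partial)
    have "partial i (partial j \<phi>) (P (p i) (p j)) = partial j (partial i \<phi>) (P (p i) (p j))"
      by (rule mixed_derivatives_eq[where F = "\<lambda>s t. \<phi> (P s t)" and Fs = "\<lambda>s t. partial i \<phi> (P s t)"
            and Ft = "\<lambda>s t. partial j \<phi> (P s t)"])
        (intro di dj c sm assms(1))+
    then show "partial i (partial j \<phi>) p = partial j (partial i \<phi>) p"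
      by (simp add: P_def)
  qed
qed simp

section \<open>The algebra of superfunctions\<close>

text \<open>The sign in \<open>smult\<close>: for disjoint \<open>A\<close> and \<open>B\<close>, it
  sorts the product of the \<theta> over \<open>A\<close> followed by the \<theta> over
  \<open>B\<close>.\<close>

definition shuffle_sign :: "nat set \<Rightarrow> nat set \<Rightarrow> real" where
  "shuffle_sign A B = (-1) ^ card {(a, b). a \<in> A \<and> b \<in> B \<and> b < a}"

lemma finite_inversions: "finite A \<Longrightarrow> finite B \<Longrightarrow> finite {(a, b). a \<in> A \<and> b \<in> B \<and> b < (a::nat)}"
  by (rule finite_subset[of _ "A \<times> B"]) auto

lemma card_eq_card_add_card_Diff: "finite J \<Longrightarrow> K \<subseteq> J \<Longrightarrow> card J = card K + card (J - K)"
  using card_Un_disjoint[of K "J - K"] by (simp add: finite_subset Un_absorb1)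

text \<open>Inversions split along a disjoint union, so the sign is multiplicative in each argument;
  associativity of \<open>\<odot>\<close> and the odd Leibniz rule rest on this.\<close>

lemma shuffle_sign_Un_left:
  assumes "finite A" "finite A'" "finite B" "A \<inter> A' = {}"
  shows "shuffle_sign (A \<union> A') B = shuffle_sign A B * shuffle_sign A' B"
proof -
  have "{(a, b). a \<in> A \<union> A' \<and> b \<in> B \<and> b < a} =
      {(a, b). a \<in> A \<and> b \<in> B \<and> b < a} \<union> {(a, b). a \<in> A' \<and> b \<in> B \<and> b < a}" by auto
  then have "card {(a, b). a \<in> A \<union> A' \<and> b \<in> B \<and> b < a} =
      card {(a, b). a \<in> A \<and> b \<in> B \<and> b < a} + card {(a, b). a \<in> A' \<and> b \<in> B \<and> b < a}"
    using assms by (simp add: card_Un_disjoint finite_inversions disjoint_iff)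
  then show ?thesis by (simp only: shuffle_sign_def power_add)
qed

lemma shuffle_sign_Un_right:
  assumes "finite A" "finite B" "finite B'" "B \<inter> B' = {}"
  shows "shuffle_sign A (B \<union> B') = shuffle_sign A B * shuffle_sign A B'"
proof -
  have "{(a, b). a \<in> A \<and> b \<in> B \<union> B' \<and> b < a} =
      {(a, b). a \<in> A \<and> b \<in> B \<and> b < a} \<union> {(a, b). a \<in> A \<and> b \<in> B' \<and> b < a}" by auto
  then have "card {(a, b). a \<in> A \<and> b \<in> B \<union> B' \<and> b < a} =
      card {(a, b). a \<in> A \<and> b \<in> B \<and> b < a} + card {(a, b). a \<in> A \<and> b \<in> B' \<and> b < a}"
    using assms by (simp add: card_Un_disjoint finite_inversions disjoint_iff)
  then show ?thesis by (simp only: shuffle_sign_def power_add)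
qed

lemma shuffle_sign_empty [simp]: "shuffle_sign {} B = 1" "shuffle_sign A {} = 1"
  by (simp_all add: shuffle_sign_def)

lemma shuffle_sign_square [simp]: "shuffle_sign A B * shuffle_sign A B = 1"
  by (simp add: shuffle_sign_def power_mult_distrib[symmetric])

lemma shuffle_sign_square_left [simp]: "shuffle_sign A B * (shuffle_sign A B * x) = x"
  by (simp only: mult.assoc[symmetric] shuffle_sign_square mult_1)

text \<open>Each pair of distinct elements is inverted in exactly one of the two orders, so the two
  inversion counts add up to \<open>card A * card B\<close>.\<close>

lemma shuffle_sign_swap:
  assumes "finite A" "finite B" "A \<inter> B = {}"
  shows "shuffle_sign A B = (-1) ^ (card A * card B) * shuffle_sign B A"
proof -
  let ?I = "\<lambda>A B. {(a, b). a \<in> A \<and> b \<in> B \<and> b < (a::nat)}"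
  have "A \<times> B = ?I A B \<union> prod.swap ` ?I B A"
    using assms(3) by (force simp: neq_iff)
  then have "card (A \<times> B) = card (?I A B) + card (prod.swap ` ?I B A)"
    using assms by (simp add: card_Un_disjoint finite_inversions disjoint_iff)
  moreover have "card (prod.swap ` ?I B A) = card (?I B A)"
    by (intro card_image) (auto simp: inj_on_def)
  ultimately have "card A * card B + card (?I B A) = card (?I A B) + 2 * card (?I B A)"
    by (simp only: card_cartesian_product)
  then have "(-1::real) ^ (card A * card B + card (?I B A)) = (-1) ^ card (?I A B)"
    by (simp add: power_add)
  then show ?thesis by (simp add: shuffle_sign_def power_add)
qed

lemma shuffle_sign_singleton: "shuffle_sign {j} J = (-1) ^ card {a \<in> J. a < j}"
proof -
  have "card {(a, b). a \<in> {j} \<and> b \<in> J \<and> b < a} = card (Pair j ` {a \<in> J. a < j})"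
    by (rule arg_cong[where f = card]) auto
  also have "\<dots> = card {a \<in> J. a < j}" by (intro card_image) (auto simp: inj_on_def)
  finally show ?thesis by (simp add: shuffle_sign_def)
qed

lemma sum_closed:
  assumes "P 0" "\<And>x y. P x \<Longrightarrow> P y \<Longrightarrow> P (x + y)" "\<And>x. x \<in> A \<Longrightarrow> P (f x)"
  shows "P (sum f A)"
  using assms(3) by (induction A rule: infinite_finite_induct) (simp_all add: assms(1,2))

section \<open>The supercommutative product\<close>

lemma smult_eq: "(f \<odot> g) J p = (\<Sum>K\<in>Pow J. shuffle_sign K (J - K) * f K p * g (J - K) p)"
  by (simp add: smult_def shuffle_sign_def)

lemma smult_infinite: "infinite J \<Longrightarrow> (f \<odot> g) J p = 0"
  by (simp add: smult_eq)

text \<open>Both sides run over the ordered partitions of \<open>J\<close> into three blocks: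
  \<open>L\<close>, \<open>K - L\<close>, \<open>J - K\<close> on the left, and \<open>L\<close>,
  \<open>M\<close> and the rest on the right. The signs agree because each is the product of the
  three pairwise shuffle signs. On infinite \<open>J\<close> both sides are 0 by the convention for
  infinite sums.\<close>

lemma smult_assoc: "(f \<odot> g) \<odot> h = f \<odot> (g \<odot> h)"
proof (intro ext)
  fix J p
  show "((f \<odot> g) \<odot> h) J p = (f \<odot> (g \<odot> h)) J p"
  proof (cases "finite J")
    case True
    have fin: "K \<subseteq> J \<Longrightarrow> finite K" for K using True finite_subset by blast
    have "((f \<odot> g) \<odot> h) J p = (\<Sum>(K, L)\<in>Sigma (Pow J) Pow.
        shuffle_sign K (J - K) * shuffle_sign L (K - L) * f L p * g (K - L) p * h (J - K) p)"
      using fin True by (subst sum.Sigma[symmetric])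
        (auto simp: smult_eq sum_distrib_left sum_distrib_right mult_ac intro!: sum.cong)
    also have "\<dots> = (\<Sum>(L, M)\<in>Sigma (Pow J) (\<lambda>L. Pow (J - L)).
        shuffle_sign L (J - L) * shuffle_sign M (J - L - M) * f L p * g M p * h (J - L - M) p)"
    proof (rule sum.reindex_bij_witness[where i = "\<lambda>(L, M). (L \<union> M, L)" and j = "\<lambda>(K, L). (L, K - L)"])
      fix x assume "x \<in> Sigma (Pow J) Pow"
      then obtain K L where x: "x = (K, L)" and KL: "K \<subseteq> J" "L \<subseteq> K" by auto
      have eq: "J - L - (K - L) = J - K" "J - L = (K - L) \<union> (J - K)" using KL by auto
      have "shuffle_sign L (J - L) = shuffle_sign L (K - L) * shuffle_sign L (J - K)"
        unfolding eq(2) using KL True by (intro shuffle_sign_Un_right) (auto intro: fin)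
      moreover have "shuffle_sign ((K - L) \<union> L) (J - K) = shuffle_sign (K - L) (J - K) * shuffle_sign L (J - K)"
        using KL True by (intro shuffle_sign_Un_left) (auto intro: fin)
      moreover have "(K - L) \<union> L = K" using KL by auto
      ultimately have "shuffle_sign L (J - L) * shuffle_sign (K - L) (J - K)
          = shuffle_sign K (J - K) * shuffle_sign L (K - L)"
        by simp
      then show "(case (case x of (K, L) \<Rightarrow> (L, K - L)) of (L, M) \<Rightarrow>
          shuffle_sign L (J - L) * shuffle_sign M (J - L - M) * f L p * g M p * h (J - L - M) p)
        = (case x of (K, L) \<Rightarrow> shuffle_sign K (J - K) * shuffle_sign L (K - L) * f L p * g (K - L) p * h (J - K) p)"
        by (simp only: x prod.case eq(1))
    qed auto
    also have "\<dots> = (f \<odot> (g \<odot> h)) J p"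
      using fin True by (subst sum.Sigma[symmetric])
        (auto simp: smult_eq sum_distrib_left sum_distrib_right mult_ac intro!: sum.cong)
    finally show ?thesis .
  qed (simp add: smult_infinite)
qed

lemma smult_add_left: "(f + g) \<odot> h = f \<odot> h + g \<odot> h"
  by (simp add: fun_eq_iff smult_eq algebra_simps sum.distrib)

lemma smult_add_right: "f \<odot> (g + h) = f \<odot> g + f \<odot> h"
  by (simp add: fun_eq_iff smult_eq algebra_simps sum.distrib)

lemma smult_zero [simp]: "0 \<odot> f = 0" "f \<odot> 0 = 0"
  by (simp_all add: fun_eq_iff smult_eq)

lemma smult_sum_left: "(\<Sum>x\<in>A. f x) \<odot> g = (\<Sum>x\<in>A. f x \<odot> g)"
  using sum_comp_morphism[of "\<lambda>h. h \<odot> g" f A] by (simp add: smult_add_left o_def)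

lemma smult_sum_right: "f \<odot> (\<Sum>x\<in>A. g x) = (\<Sum>x\<in>A. f \<odot> g x)"
  using sum_comp_morphism[of "\<lambda>h. f \<odot> h" g A] by (simp add: smult_add_right o_def)

lemma smult_sscale_left: "sscale c f \<odot> g = sscale c (f \<odot> g)"
  by (simp add: fun_eq_iff smult_eq sscale_def sum_distrib_left mult_ac)

lemma smult_sscale_right: "f \<odot> sscale c g = sscale c (f \<odot> g)"
  by (simp add: fun_eq_iff smult_eq sscale_def sum_distrib_left mult_ac)

lemma sscale_add: "sscale c (f + g) = sscale c f + sscale c g"
  by (simp add: fun_eq_iff sscale_def algebra_simps)

lemma sscale_add_left: "sscale (c + d) f = sscale c f + sscale d f"
  by (simp add: fun_eq_iff sscale_def algebra_simps)

lemma sscale_sscale [simp]: "sscale c (sscale d f) = sscale (c * d) f"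
  by (simp add: fun_eq_iff sscale_def)

lemma sscale_one [simp]: "sscale 1 f = f"
  by (simp add: fun_eq_iff sscale_def)

lemma sscale_zero [simp]: "sscale 0 f = 0" "sscale c 0 = 0"
  by (simp_all add: fun_eq_iff sscale_def)

lemma sscale_minus_one: "sscale (-1) f = - f"
  by (simp add: fun_eq_iff sscale_def)

lemma diff_eq_sscale: "f - g = f + sscale (-1) (g :: sfun)"
  by (simp add: sscale_minus_one)

lemma sscale_sum: "sscale c (\<Sum>x\<in>A. f x) = (\<Sum>x\<in>A. sscale c (f x))"
  using sum_comp_morphism[of "sscale c" f A] by (simp add: sscale_add o_def)

text \<open>The parity involution \<open>f\<^sub>J \<mapsto> (-1)\<^bsup>a|J|\<^esup> f\<^sub>J\<close> replaces all Koszul signs of inhomogeneous elements.\<close>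

definition parity_twist :: "nat \<Rightarrow> sfun \<Rightarrow> sfun" where
  "parity_twist a f = (\<lambda>J p. (-1) ^ (a * card J) * f J p)"

text \<open>Only the evenness of \<open>a\<close> matters, so parities add without reduction modulo
  2, and 0 is homogeneous of every parity.\<close>

definition homogeneous :: "nat \<Rightarrow> sfun \<Rightarrow> bool" where
  "homogeneous a f \<longleftrightarrow> (\<forall>J p. f J p \<noteq> 0 \<longrightarrow> even (card J) = even a)"

lemma parity_twist_apply: "parity_twist a f J p = (-1) ^ (a * card J) * f J p"
  by (simp add: parity_twist_def)

lemma sscale_apply: "sscale c f J p = c * f J p"
  by (simp add: sscale_def)

lemma parity_twist_twist: "parity_twist (a + b) (parity_twist b f) = parity_twist a f"
  by (simp add: fun_eq_iff parity_twist_apply distrib_right power_add mult.assoc)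

lemma parity_twist_0 [simp]: "parity_twist 0 f = f"
  by (simp add: parity_twist_def)

lemma parity_twist_add: "parity_twist a (f + g) = parity_twist a f + parity_twist a g"
  by (simp add: fun_eq_iff parity_twist_def algebra_simps)

lemma parity_twist_twice [simp]: "parity_twist a (parity_twist a f) = f"
  by (simp add: fun_eq_iff parity_twist_def power_add[symmetric] flip: mult.assoc)

text \<open>\<open>card\<close> is additive on complementary subsets of a finite set, so the
  involution is an algebra automorphism.\<close>

lemma parity_twist_smult: "parity_twist a (f \<odot> g) = parity_twist a f \<odot> parity_twist a g"
proof (intro ext)
  fix J p
  show "parity_twist a (f \<odot> g) J p = (parity_twist a f \<odot> parity_twist a g) J p"
  proof (cases "finite J")
    case True
    have "(-1::real) ^ (a * card J) = (-1) ^ (a * card K) * (-1) ^ (a * card (J - K))" if "K \<subseteq> J" for K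
    proof -
      have "card J = card K + card (J - K)"
        using True that by (rule card_eq_card_add_card_Diff)
      then show ?thesis by (simp add: distrib_left power_add)
    qed
    then show ?thesis by (simp add: parity_twist_def smult_eq sum_distrib_left mult_ac)
  qed (simp add: parity_twist_def smult_infinite)
qed

lemma sign_cong: "even m = even n \<Longrightarrow> (-1::real) ^ m = (-1) ^ n"
  by (cases "even m") auto

lemma parity_twist_homogeneous:
  assumes "homogeneous b f" shows "parity_twist a f = sscale ((-1) ^ (a * b)) f"
proof (intro ext)
  fix J p
  show "parity_twist a f J p = sscale ((-1) ^ (a * b)) f J p"
    using assms sign_cong[of "a * card J" "a * b"]
    by (cases "f J p = 0") (auto simp: homogeneous_def parity_twist_def sscale_def)
qed

text \<open>One homogeneous factor suffices if the sign is read off the other one component by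
  component: swapping costs \<open>card (J - K) * card K\<close> transpositions, and where
  \<open>f\<close> is nonzero, \<open>card (J - K)\<close> has the parity of
  \<open>a\<close>.\<close>

lemma smult_supercommute:
  assumes "homogeneous a f" shows "f \<odot> g = parity_twist a g \<odot> f"
proof (intro ext)
  fix J p
  show "(f \<odot> g) J p = (parity_twist a g \<odot> f) J p"
  proof (cases "finite J")
    case True
    have "(f \<odot> g) J p = (\<Sum>K\<in>Pow J. shuffle_sign (J - K) K * f (J - K) p * g K p)"
      unfolding smult_eq
      by (rule sum.reindex_bij_witness[where i = "\<lambda>K. J - K" and j = "\<lambda>K. J - K"]) (auto simp: double_diff)
    also have "\<dots> = (parity_twist a g \<odot> f) J p"
      unfolding smult_eq
    proof (rule sum.cong[OF refl])
      fix K assume "K \<in> Pow J"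
      then have "finite K" using True finite_subset by blast
      then have 1: "shuffle_sign (J - K) K = (-1) ^ (card (J - K) * card K) * shuffle_sign K (J - K)"
        using True by (intro shuffle_sign_swap) auto
      have "(-1::real) ^ (card (J - K) * card K) * f (J - K) p = (-1) ^ (a * card K) * f (J - K) p"
        using assms sign_cong[of "card (J - K) * card K" "a * card K"]
        by (cases "f (J - K) p = 0") (auto simp: homogeneous_def)
      then show "shuffle_sign (J - K) K * f (J - K) p * g K p =
          shuffle_sign K (J - K) * parity_twist a g K p * f (J - K) p"
        unfolding 1 parity_twist_def by (simp add: mult_ac)
    qed
    finally show ?thesis .
  qed (simp add: smult_infinite)
qed

lemma homogeneous_smult:
  assumes "homogeneous a f" "homogeneous b g" shows "homogeneous (a + b) (f \<odot> g)"
  unfolding homogeneous_def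
proof (intro allI impI)
  fix J p assume nz: "(f \<odot> g) J p \<noteq> 0"
  then have "finite J" using smult_infinite by blast
  from nz obtain K where K: "K \<subseteq> J" "f K p \<noteq> 0" "g (J - K) p \<noteq> 0"
    unfolding smult_eq by (elim sum.not_neutral_contains_not_neutral) auto
  have "card J = card K + card (J - K)"
    using \<open>finite J\<close> K(1) by (rule card_eq_card_add_card_Diff)
  then show "even (card J) = even (a + b)"
    using K(2,3) assms unfolding homogeneous_def by (metis even_add)
qed

lemma homogeneous_sscale: "homogeneous a f \<Longrightarrow> homogeneous a (sscale c f)"
  by (auto simp: homogeneous_def sscale_def)

lemma homogeneous_add: "homogeneous a f \<Longrightarrow> homogeneous a g \<Longrightarrow> homogeneous a (f + g)"
  unfolding homogeneous_def by (metis add.right_neutral plus_fun_apply)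

lemma homogeneous_zero: "homogeneous a 0"
  by (simp add: homogeneous_def)

lemma homogeneous_sum: "(\<And>x. x \<in> A \<Longrightarrow> homogeneous a (f x)) \<Longrightarrow> homogeneous a (\<Sum>x\<in>A. f x)"
  by (rule sum_closed[where P = "homogeneous a"]) (simp_all add: homogeneous_zero homogeneous_add)

lemma homogeneous_cong: "even a = even b \<Longrightarrow> homogeneous a f = homogeneous b f"
  by (simp add: homogeneous_def)

lemma homogeneous_spart: "a \<in> {0, 1} \<Longrightarrow> homogeneous a (spart a f)"
  by (auto simp: homogeneous_def spart_def split: if_splits)

lemma homogeneous_coord: "homogeneous (par l A) (coord l A)"
  by (auto simp: homogeneous_def coord_def par_def split: if_splits)

section \<open>The unit and the closure properties of superfunctions\<close>

definition sone :: sfun where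
  "sone = (\<lambda>J p. if J = {} then 1 else 0)"

lemma superfunctions_outside:
  assumes "f \<in> superfunctions l n" "\<not> J \<subseteq> {1..n}" shows "f J = 0"
  using assms by (auto simp: superfunctions_def)

lemma superfunctions_smooth:
  assumes "f \<in> superfunctions l n" shows "smooth (Suc (2 * l)) (f J)"
  using assms smooth_zero[of "Suc (2 * l)"] unfolding superfunctions_def Suc_eq_plus1[symmetric]
  by (cases "J \<subseteq> {1..n}") auto

lemma superfunctionsI:
  assumes "\<And>J. smooth (Suc (2 * l)) (f J)" "\<And>J p. \<not> J \<subseteq> {1..n} \<Longrightarrow> f J p = 0"
  shows "f \<in> superfunctions l n"
  using assms by (auto simp: superfunctions_def fun_eq_iff)

lemma superfunctions_zero: "0 \<in> superfunctions l n"
  by (rule superfunctionsI) (auto simp: smooth_zero)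

lemma superfunctions_sone: "sone \<in> superfunctions l n"
  by (rule superfunctionsI) (auto simp: sone_def smooth_const)

lemma superfunctions_add:
  assumes "f \<in> superfunctions l n" "g \<in> superfunctions l n" shows "f + g \<in> superfunctions l n"
  by (rule superfunctionsI)
    (auto simp: plus_fun_def superfunctions_outside[OF assms(1)] superfunctions_outside[OF assms(2)]
      intro!: smooth_add superfunctions_smooth[OF assms(1)] superfunctions_smooth[OF assms(2)])

lemma superfunctions_sscale:
  assumes "f \<in> superfunctions l n" shows "sscale c f \<in> superfunctions l n"
  by (rule superfunctionsI)
    (auto simp: sscale_def superfunctions_outside[OF assms] intro!: smooth_cmult superfunctions_smooth[OF assms])

lemma superfunctions_diff:
  "f \<in> superfunctions l n \<Longrightarrow> g \<in> superfunctions l n \<Longrightarrow> f - g \<in> superfunctions l n"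
  unfolding diff_eq_sscale by (intro superfunctions_add superfunctions_sscale)

lemma superfunctions_sum:
  "(\<And>x. x \<in> A \<Longrightarrow> f x \<in> superfunctions l n) \<Longrightarrow> (\<Sum>x\<in>A. f x) \<in> superfunctions l n"
  by (rule sum_closed[where P = "\<lambda>f. f \<in> superfunctions l n"]) (simp_all add: superfunctions_zero superfunctions_add)

lemma superfunctions_twist:
  assumes "f \<in> superfunctions l n" shows "parity_twist a f \<in> superfunctions l n"
  by (rule superfunctionsI)
    (auto simp: parity_twist_def superfunctions_outside[OF assms] intro!: smooth_cmult superfunctions_smooth[OF assms])

lemma superfunctions_spart:
  assumes "f \<in> superfunctions l n" shows "spart a f \<in> superfunctions l n"
  by (rule superfunctionsI)
    (auto simp: spart_def superfunctions_outside[OF assms] intro!: smooth_zero superfunctions_smooth[OF assms])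

lemma superfunctions_smult:
  assumes "f \<in> superfunctions l n" "g \<in> superfunctions l n" shows "f \<odot> g \<in> superfunctions l n"
proof (rule superfunctionsI)
  fix J
  have "(f \<odot> g) J = (\<lambda>p. \<Sum>K\<in>Pow J. (shuffle_sign K (J - K) * f K p) * g (J - K) p)"
    by (simp add: fun_eq_iff smult_eq)
  then show "smooth (Suc (2 * l)) ((f \<odot> g) J)"
    by (auto intro!: smooth_sum smooth_mult smooth_const superfunctions_smooth[OF assms(1)] superfunctions_smooth[OF assms(2)])
next
  fix J p assume "\<not> J \<subseteq> {1..n}"
  then have "f K p = 0 \<or> g (J - K) p = 0" if "K \<subseteq> J" for K
    using superfunctions_outside[OF assms(1), of K] superfunctions_outside[OF assms(2), of "J - K"] that
    by (auto simp: fun_eq_iff)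
  then show "(f \<odot> g) J p = 0"
    unfolding smult_eq by (intro sum.neutral) auto
qed

lemma superfunctions_coord:
  assumes "A \<le> 2 * l + n" shows "coord l A \<in> superfunctions l n"
proof (rule superfunctionsI)
  fix J
  have "coord l A J = (if A \<le> 2 * l then if J = {} then (\<lambda>p. p A) else (\<lambda>p. 0)
      else (\<lambda>p. if J = {A - 2 * l} then 1 else 0))"
    by (auto simp: coord_def)
  then show "smooth (Suc (2 * l)) (coord l A J)"
    by (simp add: smooth_const smooth_coordinate)
qed (use assms in \<open>auto simp: coord_def split: if_splits\<close>)

text \<open>The product is 0 on infinite index sets, so \<open>sone\<close> acts as a unit only
  where these components vanish, as they do for superfunctions.\<close>

lemma sone_smult:
  assumes "f \<in> superfunctions l n" shows "sone \<odot> f = f"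
proof (intro ext)
  fix J p
  show "(sone \<odot> f) J p = f J p"
  proof (cases "finite J")
    case True
    have "(sone \<odot> f) J p = (\<Sum>K\<in>Pow J. if K = {} then f J p else 0)"
      unfolding smult_eq by (intro sum.cong) (auto simp: sone_def)
    then show ?thesis using True by simp
  next
    case False
    then have "\<not> J \<subseteq> {1..n}" using finite_subset by blast
    then show ?thesis using False superfunctions_outside[OF assms] by (simp add: smult_infinite)
  qed
qed

section \<open>Coordinate derivatives\<close>

lemma dq_even: "A \<le> 2 * l \<Longrightarrow> dq l A f J = partial A (f J)"
  by (simp add: dq_def)

lemma dq_odd: "2 * l < A \<Longrightarrow> dq l A f J p =
    (if A - 2 * l \<in> J then 0 else shuffle_sign {A - 2 * l} J * f (insert (A - 2 * l) J) p)"
  by (simp add: dq_def shuffle_sign_singleton)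

lemma superfunctions_dq:
  assumes "f \<in> superfunctions l n" shows "dq l A f \<in> superfunctions l n"
proof (cases "A \<le> 2 * l")
  case True
  then show ?thesis
    by (intro superfunctionsI) (auto simp: dq_even superfunctions_outside[OF assms]
        intro!: smooth_partial superfunctions_smooth[OF assms])
next
  case False
  show ?thesis
  proof (rule superfunctionsI)
    fix J
    have "dq l A f J = (\<lambda>p. (if A - 2 * l \<in> J then 0 else shuffle_sign {A - 2 * l} J)
        * f (insert (A - 2 * l) J) p)"
      using False by (auto simp: fun_eq_iff dq_odd)
    then show "smooth (Suc (2 * l)) (dq l A f J)"
      by (simp only: smooth_cmult superfunctions_smooth[OF assms])
  next
    fix J p assume "\<not> J \<subseteq> {1..n}"
    then show "dq l A f J p = 0"
      using False superfunctions_outside[OF assms, of "insert (A - 2 * l) J"] by (auto simp: dq_odd)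
  qed
qed

lemma dq_add:
  assumes "f \<in> superfunctions l n" "g \<in> superfunctions l n"
  shows "dq l A (f + g) = dq l A f + dq l A g"
proof (intro ext)
  fix J p
  show "dq l A (f + g) J p = (dq l A f + dq l A g) J p"
    using partial_add[OF superfunctions_smooth[OF assms(1)] superfunctions_smooth[OF assms(2)], of A J J]
    by (cases "A \<le> 2 * l") (simp_all add: dq_even dq_odd plus_fun_def algebra_simps)
qed

lemma dq_sscale:
  assumes "f \<in> superfunctions l n"
  shows "dq l A (sscale c f) = sscale c (dq l A f)"
proof (intro ext)
  fix J p
  show "dq l A (sscale c f) J p = sscale c (dq l A f) J p"
    using partial_cmult[OF superfunctions_smooth[OF assms], of A c J]
    by (cases "A \<le> 2 * l") (simp_all add: dq_even dq_odd sscale_def)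
qed

lemma homogeneous_dq:
  assumes "f \<in> superfunctions l n" "homogeneous a f"
  shows "homogeneous (a + par l A) (dq l A f)"
  unfolding homogeneous_def
proof (intro allI impI)
  fix J p assume nz: "dq l A f J p \<noteq> 0"
  show "even (card J) = even (a + par l A)"
  proof (cases "A \<le> 2 * l")
    case True
    then have "partial A (f J) \<noteq> 0" using nz by (auto simp: dq_even)
    then have "f J \<noteq> 0" by auto
    then show ?thesis using assms(2) True by (auto simp: homogeneous_def par_def fun_eq_iff)
  next
    case False
    then have *: "A - 2 * l \<notin> J" "f (insert (A - 2 * l) J) p \<noteq> 0" using nz by (auto simp: dq_odd split: if_splits)
    have "insert (A - 2 * l) J \<subseteq> {1..n}"
    proof (rule ccontr)
      assume "\<not> insert (A - 2 * l) J \<subseteq> {1..n}"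
      from superfunctions_outside[OF assms(1) this] * show False by simp
    qed
    then have "finite J" using finite_subset[of J "{1..n}"] by auto
    then have "card (insert (A - 2 * l) J) = Suc (card J)" using * by simp
    then show ?thesis using assms(2) * False unfolding homogeneous_def par_def by fastforce
  qed
qed

lemma dq_twist:
  assumes "f \<in> superfunctions l n"
  shows "dq l A (parity_twist a f) = sscale ((-1) ^ (a * par l A)) (parity_twist a (dq l A f))"
proof (intro ext)
  fix J :: "nat set" and p
  define s where "s = (-1::real) ^ (a * card J)"
  show "dq l A (parity_twist a f) J p = sscale ((-1) ^ (a * par l A)) (parity_twist a (dq l A f)) J p"
  proof (cases "A \<le> 2 * l")
    case True
    have "parity_twist a f J = (\<lambda>p. s * f J p)"
      by (simp add: parity_twist_def s_def)
    then have "partial A (parity_twist a f J) p = s * partial A (f J) p"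
      using partial_cmult[OF superfunctions_smooth[OF assms], of A s J] True by simp
    then show ?thesis
      using True by (simp add: dq_even sscale_apply parity_twist_apply par_def s_def)
  next
    case False
    then have d: "dq l A g J p = (if A - 2 * l \<in> J then 0
        else shuffle_sign {A - 2 * l} J * g (insert (A - 2 * l) J) p)" for g
      by (simp add: dq_odd)
    consider "A - 2 * l \<in> J" | "A - 2 * l \<notin> J" "finite J" | "infinite J" by blast
    then show ?thesis
    proof cases
      case 1
      then show ?thesis by (simp add: d sscale_apply parity_twist_apply)
    next
      case 2
      then have "(-1::real) ^ (a * card (insert (A - 2 * l) J)) = (-1) ^ (a * par l A) * s"
        using False by (simp add: s_def par_def power_add)
      then show ?thesis
        using 2 by (simp only: d sscale_apply parity_twist_apply s_def if_False mult_ac)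
    next
      \<comment> \<open>\<open>card\<close> is 0 on infinite sets, so the parity count of the
        previous case fails; but these components of a superfunction vanish.\<close>
      case 3
      then have "\<not> insert (A - 2 * l) J \<subseteq> {1..n}" using finite_subset[of J "{1..n}"] by auto
      then have "f (insert (A - 2 * l) J) p = 0"
        using superfunctions_outside[OF assms] by simp
      then show ?thesis by (simp add: d sscale_apply parity_twist_apply)
    qed
  qed
qed

lemma sum_Pow_insert:
  assumes "finite J" "j \<notin> J"
  shows "(\<Sum>K\<in>Pow (insert j J). F K) = (\<Sum>K\<in>Pow J. F K) + (\<Sum>K\<in>Pow J. F (insert j K))"
proof -
  have "(\<Sum>K\<in>Pow (insert j J). F K) = (\<Sum>K\<in>Pow J. F K) + (\<Sum>K\<in>insert j ` Pow J. F K)"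
    unfolding Pow_insert using assms by (intro sum.union_disjoint) auto
  also have "(\<Sum>K\<in>insert j ` Pow J. F K) = (\<Sum>K\<in>Pow J. F (insert j K))"
    using assms(2) by (subst sum.reindex) (auto simp: inj_on_def)
  finally show ?thesis .
qed

lemma shuffle_sign_insert_left:
  "finite K \<Longrightarrow> finite B \<Longrightarrow> j \<notin> K \<Longrightarrow> shuffle_sign (insert j K) B = shuffle_sign {j} B * shuffle_sign K B"
  using shuffle_sign_Un_left[of "{j}" K B] by simp

lemma shuffle_sign_insert_right:
  "finite A \<Longrightarrow> finite B \<Longrightarrow> j \<notin> B \<Longrightarrow> shuffle_sign A (insert j B) = shuffle_sign A {j} * shuffle_sign A B"
  using shuffle_sign_Un_right[of A "{j}" B] by simp

text \<open>If \<open>j \<notin> J\<close>, the subsets of \<open>insert j J\<close> that contain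
  \<open>j\<close> give the first term and the others the second. If \<open>j \<in> J\<close>, the
  left side is 0, and every product of two components that both contain \<open>j\<close> arises once
  from each term, with opposite signs.\<close>

lemma dq_odd_smult:
  assumes "2 * l < A"
  shows "dq l A (f \<odot> g) = dq l A f \<odot> g + parity_twist 1 f \<odot> dq l A g"
proof (intro ext)
  fix J p
  define j where "j = A - 2 * l"
  have d: "dq l A f J p = (if j \<in> J then 0 else shuffle_sign {j} J * f (insert j J) p)" for f J
    using assms by (simp add: dq_odd j_def)
  \<comment> \<open>Moving the derivative past the first factor costs this sign, the origin of
    \<open>parity_twist 1\<close>.\<close>
  have swap: "shuffle_sign K {j} = (-1) ^ card K * shuffle_sign {j} K" if "finite K" "j \<notin> K" for K
    using shuffle_sign_swap[of K "{j}"] that by simp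
  show "dq l A (f \<odot> g) J p = (dq l A f \<odot> g + parity_twist 1 f \<odot> dq l A g) J p"
  proof (cases "finite J")
    case False
    then show ?thesis by (simp add: d smult_infinite)
  next
    case fin: True
    have finK: "finite K" if "K \<subseteq> J" for K using fin that finite_subset by blast
    show ?thesis
    proof (cases "j \<in> J")
      case False
      have split: "shuffle_sign {j} J = shuffle_sign {j} K * shuffle_sign {j} (J - K)" if "K \<subseteq> J" for K
        using shuffle_sign_Un_right[of "{j}" K "J - K"] that finK[OF that] fin
        by (simp add: Un_absorb1)
      have "dq l A (f \<odot> g) J p = (\<Sum>K\<in>Pow J. shuffle_sign {j} J *
            (shuffle_sign K (insert j J - K) * f K p * g (insert j J - K) p))
          + (\<Sum>K\<in>Pow J. shuffle_sign {j} J * (shuffle_sign (insert j K) (insert j J - insert j K)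
              * f (insert j K) p * g (insert j J - insert j K) p))"
        using False fin by (simp add: d smult_eq sum_Pow_insert distrib_left sum_distrib_left)
      also have "(\<Sum>K\<in>Pow J. shuffle_sign {j} J *
            (shuffle_sign K (insert j J - K) * f K p * g (insert j J - K) p))
          = (parity_twist 1 f \<odot> dq l A g) J p"
        unfolding smult_eq
      proof (rule sum.cong[OF refl])
        fix K assume "K \<in> Pow J"
        then have K: "K \<subseteq> J" "finite K" "finite (J - K)" "j \<notin> K" "j \<notin> J - K"
          using False finK fin by auto
        have "insert j J - K = insert j (J - K)" using K by auto
        then show "shuffle_sign {j} J * (shuffle_sign K (insert j J - K) * f K p * g (insert j J - K) p) =
            shuffle_sign K (J - K) * parity_twist 1 f K p * dq l A g (J - K) p"
          using K False
          by (simp add: d split[OF K(1)] shuffle_sign_insert_right[OF K(2,3,5)] swap parity_twist_def mult_ac)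
      qed
      also have "(\<Sum>K\<in>Pow J. shuffle_sign {j} J * (shuffle_sign (insert j K) (insert j J - insert j K)
              * f (insert j K) p * g (insert j J - insert j K) p)) = (dq l A f \<odot> g) J p"
        unfolding smult_eq
      proof (rule sum.cong[OF refl])
        fix K assume "K \<in> Pow J"
        then have K: "K \<subseteq> J" "finite K" "finite (J - K)" "j \<notin> K" "j \<notin> J - K"
          using False finK fin by auto
        have "insert j J - insert j K = J - K" using K False by auto
        then show "shuffle_sign {j} J * (shuffle_sign (insert j K) (insert j J - insert j K)
              * f (insert j K) p * g (insert j J - insert j K) p) =
            shuffle_sign K (J - K) * dq l A f K p * g (J - K) p"
          using K False
          by (simp add: d split[OF K(1)] shuffle_sign_insert_left[OF K(2,3,4)] mult_ac)
      qed
      finally show ?thesis by simp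
    next
      case True
      \<comment> \<open>Removing \<open>j\<close> splits \<open>Pow J\<close> into the subsets
        without and with \<open>j\<close>; only the former contribute to the first term and only the
        latter to the second.\<close>
      define J' where "J' = J - {j}"
      have J': "J = insert j J'" "j \<notin> J'" "finite J'" using True fin by (auto simp: J'_def)
      have "(dq l A f \<odot> g) J p = (\<Sum>K\<in>Pow J'. shuffle_sign K (J - K) * dq l A f K p * g (J - K) p)"
        unfolding smult_eq J'(1) sum_Pow_insert[OF J'(3,2)] by (simp add: d)
      moreover have "(parity_twist 1 f \<odot> dq l A g) J p = (\<Sum>K\<in>Pow J'. shuffle_sign (insert j K) (J - insert j K) *
          parity_twist 1 f (insert j K) p * dq l A g (J - insert j K) p)"
      proof -
        have "(\<Sum>K\<in>Pow J'. shuffle_sign K (insert j J' - K) * parity_twist 1 f K p * dq l A g (insert j J' - K) p) = 0"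
          using J' by (intro sum.neutral) (auto simp: d)
        then show ?thesis unfolding smult_eq J'(1) sum_Pow_insert[OF J'(3,2)] by simp
      qed
      moreover have "(\<Sum>K\<in>Pow J'. shuffle_sign K (J - K) * dq l A f K p * g (J - K) p)
          = - (\<Sum>K\<in>Pow J'. shuffle_sign (insert j K) (J - insert j K) *
          parity_twist 1 f (insert j K) p * dq l A g (J - insert j K) p)"
        unfolding sum_negf[symmetric]
      proof (rule sum.cong[OF refl])
        fix K assume "K \<in> Pow J'"
        then have K: "K \<subseteq> J'" "finite K" "finite (J' - K)" "j \<notin> K" "j \<notin> J' - K"
          using J' finK by auto
        have eq: "J - K = insert j (J' - K)" "J - insert j K = J' - K" using K J' by auto
        show "shuffle_sign K (J - K) * dq l A f K p * g (J - K) p =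
            - (shuffle_sign (insert j K) (J - insert j K) *
            parity_twist 1 f (insert j K) p * dq l A g (J - insert j K) p)"
          using K unfolding eq
          by (simp add: d shuffle_sign_insert_right[OF K(2,3,5)] shuffle_sign_insert_left[OF K(2,3,4)] swap parity_twist_def mult_ac)
      qed
      ultimately show ?thesis using True by (simp add: d)
    qed
  qed
qed

lemma dq_smult:
  assumes "f \<in> superfunctions l n" "g \<in> superfunctions l n"
  shows "dq l A (f \<odot> g) = dq l A f \<odot> g + parity_twist (par l A) f \<odot> dq l A g"
proof (cases "A \<le> 2 * l")
  case False
  then show ?thesis by (simp add: dq_odd_smult par_def)
next
  case True
  show ?thesis
  proof (intro ext)
    fix J p
    have A: "A < Suc (2 * l)" using True by simp
    have sf: "smooth (Suc (2 * l)) (\<lambda>p. c * f K p)" and sg: "smooth (Suc (2 * l)) (g K)" for c K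
      by (auto intro!: smooth_cmult superfunctions_smooth[OF assms(1)] superfunctions_smooth[OF assms(2)])
    have *: "(f \<odot> g) J = (\<lambda>p. \<Sum>K\<in>Pow J. (shuffle_sign K (J - K) * f K p) * g (J - K) p)"
      by (simp add: fun_eq_iff smult_eq)
    have "partial A ((f \<odot> g) J) p = (\<Sum>K\<in>Pow J. shuffle_sign K (J - K) * partial A (f K) p * g (J - K) p
        + shuffle_sign K (J - K) * f K p * partial A (g (J - K)) p)"
      unfolding * using A
      by (simp add: partial_sum[OF smooth_mult[OF sf sg]] partial_mult[OF sf sg]
          partial_cmult[OF superfunctions_smooth[OF assms(1)]])
    then show "dq l A (f \<odot> g) J p = (dq l A f \<odot> g + parity_twist (par l A) f \<odot> dq l A g) J p"
      using True by (simp add: dq_even smult_eq par_def parity_twist_def sum.distrib)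
  qed
qed

text \<open>Even pairs commute by equality of mixed partial derivatives, mixed pairs because an odd
  derivative only relabels components up to a constant sign, and odd pairs anticommute because the
  two odd coordinates are removed in opposite orders.\<close>

lemma dq_commute:
  assumes "f \<in> superfunctions l n"
  shows "dq l A (dq l B f) = sscale ((-1) ^ (par l A * par l B)) (dq l B (dq l A f))"
proof (intro ext)
  fix J p
  have mixed: "dq l A (dq l B f) J p = dq l B (dq l A f) J p" if "A \<le> 2 * l" "2 * l < B" for A B
  proof -
    have "dq l B f J = (\<lambda>p. (if B - 2 * l \<in> J then 0 else shuffle_sign {B - 2 * l} J)
        * f (insert (B - 2 * l) J) p)"
      using that by (auto simp: fun_eq_iff dq_odd)
    then show ?thesis
      using that by (auto simp: dq_even dq_odd partial_cmult[OF superfunctions_smooth[OF assms]])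
  qed
  show "dq l A (dq l B f) J p = sscale ((-1) ^ (par l A * par l B)) (dq l B (dq l A f)) J p"
  proof (cases "A \<le> 2 * l"; cases "B \<le> 2 * l")
    assume AB: "A \<le> 2 * l" "B \<le> 2 * l"
    then show ?thesis
      using partial_commute[OF superfunctions_smooth[OF assms], of A B J]
      by (simp add: dq_def sscale_def par_def)
  next
    assume "A \<le> 2 * l" "\<not> B \<le> 2 * l"
    then show ?thesis using mixed[of A B] by (simp add: par_def)
  next
    assume "\<not> A \<le> 2 * l" "B \<le> 2 * l"
    then show ?thesis using mixed[of B A] by (simp add: par_def)
  next
    assume AB: "\<not> A \<le> 2 * l" "\<not> B \<le> 2 * l"
    define i j where "i = A - 2 * l" and "j = B - 2 * l"
    show ?thesis
    proof (cases "i \<in> J \<or> j \<in> J \<or> i = j \<or> infinite J")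
      case True
      moreover have "f (insert i (insert j J)) p = 0" if "infinite J"
      proof -
        have "\<not> insert i (insert j J) \<subseteq> {1..n}" using finite_subset[of J "{1..n}"] that by auto
        from superfunctions_outside[OF assms this] show ?thesis by simp
      qed
      ultimately have "f (insert i (insert j J)) p = 0 \<or> i \<in> J \<or> j \<in> J \<or> i = j"
        by blast
      then show ?thesis
        using AB by (auto simp: dq_odd sscale_def i_def[symmetric] j_def[symmetric] insert_commute)
    next
      case False
      have "shuffle_sign {i} {j} = - shuffle_sign {j} {i}"
        using shuffle_sign_swap[of "{i}" "{j}"] False by simp
      then show ?thesis
        using AB False
        by (auto simp: dq_odd sscale_def i_def[symmetric] j_def[symmetric] insert_commute
            shuffle_sign_insert_right[of "{i}" J j] shuffle_sign_insert_right[of "{j}" J i] par_def)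
    qed
  qed
qed

lemma dq_coord:
  assumes "A \<le> 2 * l + n" "B \<le> 2 * l + n"
  shows "dq l A (coord l B) = (if A = B then sone else 0)"
proof (intro ext)
  fix J p
  have const: "partial A (if P then (\<lambda>p. c) else (\<lambda>p. d)) = (\<lambda>p. 0)" for P c d by simp
  show "dq l A (coord l B) J p = (if A = B then sone else 0) J p"
  proof (cases "A \<le> 2 * l"; cases "B \<le> 2 * l")
    assume AB: "A \<le> 2 * l" "B \<le> 2 * l"
    have "coord l B J = (if J = {} then (\<lambda>p. p B) else (\<lambda>p. 0))" using AB by (auto simp: coord_def)
    then show ?thesis using AB by (auto simp: dq_even sone_def partial_coordinate)
  next
    assume AB: "A \<le> 2 * l" "\<not> B \<le> 2 * l"
    have "coord l B J = (\<lambda>p. if J = {B - 2 * l} then 1 else 0)" using AB by (auto simp: coord_def)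
    then show ?thesis using AB by (auto simp: dq_even)
  next
    assume AB: "\<not> A \<le> 2 * l" "B \<le> 2 * l"
    then show ?thesis by (auto simp: dq_odd coord_def)
  next
    assume AB: "\<not> A \<le> 2 * l" "\<not> B \<le> 2 * l"
    then show ?thesis by (auto simp: dq_odd coord_def sone_def)
  qed
qed

section \<open>Filtered operators generated by a frame of vector fields\<close>

text \<open>Common data of the two filtrations: fields \<open>G\<close>, weights \<open>w\<close>,
  and structure constants \<open>b A B\<close> of brackets that point along \<open>G 0\<close> only.
  \<open>w_pos\<close> makes the index sets finite, \<open>w_commute\<close> lets transpositions
  respect the weight, and \<open>w_le\<close> makes all fields other than \<open>G 0\<close> share
  the least weight.\<close>

locale frame =
  fixes l n :: nat and G :: "nat \<Rightarrow> sfun \<Rightarrow> sfun" and w :: "nat \<Rightarrow> nat" and b :: "nat \<Rightarrow> nat \<Rightarrow> real"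
  assumes G_closed: "A \<le> 2 * l + n \<Longrightarrow> g \<in> superfunctions l n \<Longrightarrow> G A g \<in> superfunctions l n"
    and G_add: "A \<le> 2 * l + n \<Longrightarrow> g \<in> superfunctions l n \<Longrightarrow> h \<in> superfunctions l n \<Longrightarrow>
      G A (g + h) = G A g + G A h"
    and G_sscale: "A \<le> 2 * l + n \<Longrightarrow> g \<in> superfunctions l n \<Longrightarrow> G A (sscale c g) = sscale c (G A g)"
    and G_smult: "A \<le> 2 * l + n \<Longrightarrow> h \<in> superfunctions l n \<Longrightarrow> g \<in> superfunctions l n \<Longrightarrow>
      G A (h \<odot> g) = G A h \<odot> g + parity_twist (par l A) h \<odot> G A g"
    and G_twist: "A \<le> 2 * l + n \<Longrightarrow> g \<in> superfunctions l n \<Longrightarrow>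
      G A (parity_twist a g) = sscale ((-1) ^ (a * par l A)) (parity_twist a (G A g))"
    and G_commute: "A \<le> 2 * l + n \<Longrightarrow> B \<le> 2 * l + n \<Longrightarrow> g \<in> superfunctions l n \<Longrightarrow>
      G A (G B g) = sscale ((-1) ^ (par l A * par l B)) (G B (G A g)) + sscale (b A B) (G 0 g)"
    and w_pos: "A \<le> 2 * l + n \<Longrightarrow> 0 < w A"
    and w_commute: "A \<le> 2 * l + n \<Longrightarrow> B \<le> 2 * l + n \<Longrightarrow> b A B \<noteq> 0 \<Longrightarrow> w 0 \<le> w A + w B"
    and w_le: "A \<le> 2 * l + n \<Longrightarrow> B \<le> 2 * l + n \<Longrightarrow> B \<noteq> 0 \<Longrightarrow> w B \<le> w A"
begin

abbreviation (input) "S \<equiv> superfunctions l n"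

lemma G_sum:
  assumes "A \<le> 2 * l + n" "finite X" "\<And>x. x \<in> X \<Longrightarrow> f x \<in> S"
  shows "G A (\<Sum>x\<in>X. f x) = (\<Sum>x\<in>X. G A (f x))"
  using assms(2,3)
proof (induction X rule: finite_induct)
  case empty
  show "G A (sum f {}) = (\<Sum>x\<in>{}. G A (f x))"
    using G_sscale[OF assms(1) superfunctions_zero, of 0] by simp
next
  case (insert x X)
  have "G A (sum f (insert x X)) = G A (f x + sum f X)" by (simp only: sum.insert[OF insert.hyps])
  also have "\<dots> = G A (f x) + G A (sum f X)"
    using insert by (intro G_add assms(1) superfunctions_sum) auto
  also have "\<dots> = (\<Sum>x\<in>insert x X. G A (f x))"
    using insert.IH insert.prems by (simp only: sum.insert[OF insert.hyps] insert_iff simp_thms)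
  finally show "G A (sum f (insert x X)) = (\<Sum>x\<in>insert x X. G A (f x))" .
qed

text \<open>Words may be unsorted and repeat odd letters. The monomials are the words
  \<open>index_word I\<close>, which turns reordering into a statement about lists.\<close>

definition word :: "nat list \<Rightarrow> sfun \<Rightarrow> sfun" where
  "word ws g = foldr G ws g"

definition word_weight :: "nat list \<Rightarrow> nat" where
  "word_weight ws = sum_list (map w ws)"

definition index_weight :: "(nat \<Rightarrow> nat) \<Rightarrow> nat" where
  "index_weight I = (\<Sum>A\<in>{0..2 * l + n}. w A * I A)"

definition indices :: "nat \<Rightarrow> (nat \<Rightarrow> nat) set" where
  "indices m = {I \<in> multi_indices l n. index_weight I \<le> m}"

definition monomial :: "(nat \<Rightarrow> nat) \<Rightarrow> sfun \<Rightarrow> sfun" where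
  "monomial I = foldr (\<lambda>A h. (G A ^^ I A) \<circ> h) [0..<2 * l + n + 1] id"

definition normal_form :: "nat \<Rightarrow> (sfun \<Rightarrow> sfun) \<Rightarrow> bool" where
  "normal_form m D \<longleftrightarrow> (\<exists>C. (\<forall>I. C I \<in> S) \<and>
     (\<forall>g\<in>S. D g = (\<Sum>I\<in>indices m. C I \<odot> monomial I g)))"

text \<open>The equations are demanded on superfunctions only, because operators are compared there
  alone. The slack in \<open>m + w A \<le> m'\<close> makes the degree an upper bound, so that
  \<open>ops_mono\<close> holds.\<close>

inductive ops :: "nat \<Rightarrow> (sfun \<Rightarrow> sfun) \<Rightarrow> bool" where
  ident: "(\<And>g. g \<in> S \<Longrightarrow> D g = g) \<Longrightarrow> ops m D"
| add: "ops m D1 \<Longrightarrow> ops m D2 \<Longrightarrow> (\<And>g. g \<in> S \<Longrightarrow> D g = D1 g + D2 g) \<Longrightarrow> ops m D"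
| smult: "h \<in> S \<Longrightarrow> ops m D1 \<Longrightarrow> (\<And>g. g \<in> S \<Longrightarrow> D g = h \<odot> D1 g) \<Longrightarrow> ops m D"
| der: "A \<le> 2 * l + n \<Longrightarrow> ops m D1 \<Longrightarrow> m + w A \<le> m' \<Longrightarrow>
    (\<And>g. g \<in> S \<Longrightarrow> D g = G A (D1 g)) \<Longrightarrow> ops m' D"

lemma word_append: "word (u @ v) g = word u (word v g)"
  by (simp add: word_def)

lemma word_simps [simp]: "word [] g = g" "word (A # ws) g = G A (word ws g)"
  by (simp_all add: word_def)

lemma word_closed: "set ws \<subseteq> {..2 * l + n} \<Longrightarrow> g \<in> S \<Longrightarrow> word ws g \<in> S"
  by (induction ws) (auto intro: G_closed)

lemma word_linear:
  assumes "set ws \<subseteq> {..2 * l + n}" "g \<in> S" "h \<in> S"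
  shows "word ws (sscale c g + sscale d h) = sscale c (word ws g) + sscale d (word ws h)"
  using assms(1)
proof (induction ws)
  case (Cons A ws)
  then have A: "A \<le> 2 * l + n" and ws: "set ws \<subseteq> {..2 * l + n}" by auto
  have "word ws (sscale c g + sscale d h) = sscale c (word ws g) + sscale d (word ws h)"
    by (rule Cons.IH[OF ws])
  then show "word (A # ws) (sscale c g + sscale d h) = sscale c (word (A # ws) g) + sscale d (word (A # ws) h)"
    using A word_closed[OF ws] assms(2,3) by (simp add: G_add G_sscale superfunctions_sscale)
qed simp

definition index_word :: "(nat \<Rightarrow> nat) \<Rightarrow> nat list" where
  "index_word I = concat (map (\<lambda>A. replicate (I A) A) [0..<2 * l + n + 1])"

lemma monomial_eq_word: "monomial I g = word (index_word I) g"
proof -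
  have "foldr (\<lambda>A h. (G A ^^ I A) \<circ> h) xs id g = word (concat (map (\<lambda>A. replicate (I A) A) xs)) g" for xs
    by (induction xs) (simp_all add: word_def foldr_replicate)
  then show ?thesis by (simp only: monomial_def index_word_def)
qed

lemma set_index_word: "set (index_word I) \<subseteq> {..2 * l + n}"
  by (auto simp: index_word_def)

lemma monomial_closed: "g \<in> S \<Longrightarrow> monomial I g \<in> S"
  by (simp add: monomial_eq_word word_closed set_index_word)

lemma word_weight_append: "word_weight (u @ v) = word_weight u + word_weight v"
  by (simp add: word_weight_def)

lemma word_weight_Cons: "word_weight (A # v) = w A + word_weight v"
  by (simp add: word_weight_def)

lemma word_weight_mset: "mset u = mset v \<Longrightarrow> word_weight u = word_weight v"
  unfolding word_weight_def by (metis mset_map sum_mset_sum_list)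

lemma word_weight_index_word: "word_weight (index_word I) = index_weight I"
proof -
  have "word_weight (concat (map (\<lambda>A. replicate (I A) A) xs)) = sum_list (map (\<lambda>A. w A * I A) xs)" for xs
    by (induction xs) (simp_all add: word_weight_def sum_list_replicate)
  then show ?thesis
    unfolding index_word_def index_weight_def
    by (simp only: interv_sum_list_conv_sum_set_nat Suc_eq_plus1[symmetric] set_upt atLeastLessThanSuc_atLeastAtMost)
qed

text \<open>Positive weights bound every single exponent by the total weight.\<close>

lemma finite_indices: "finite (indices m)"
proof (rule finite_subset)
  show "indices m \<subseteq> {I. \<forall>A. (A \<in> {0..2 * l + n} \<longrightarrow> I A \<in> {0..m}) \<and> (A \<notin> {0..2 * l + n} \<longrightarrow> I A = 0)}"
  proof (intro subsetI CollectI allI conjI impI)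
    fix I A assume I: "I \<in> indices m" and A: "A \<in> {0..2 * l + n}"
    have "I A \<le> w A * I A" using w_pos[of A] A by simp
    also have "\<dots> \<le> index_weight I" unfolding index_weight_def using A by (intro member_le_sum) auto
    finally show "I A \<in> {0..m}" using I by (simp add: indices_def)
  qed (auto simp: indices_def multi_indices_def)
  show "finite {I. \<forall>A. (A \<in> {0..2 * l + n} \<longrightarrow> I A \<in> {0..m}) \<and> (A \<notin> {0..2 * l + n} \<longrightarrow> I A = 0)}"
    by (rule finite_set_of_finite_funs) auto
qed

section \<open>Normal forms and the reordering of words\<close>

lemma normal_form_cong:
  assumes "normal_form m D1" "\<And>g. g \<in> S \<Longrightarrow> D g = D1 g"
  shows "normal_form m D"
proof -
  obtain C where "\<forall>I. C I \<in> S" "\<forall>g\<in>S. D1 g = (\<Sum>I\<in>indices m. C I \<odot> monomial I g)"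
    using assms(1) unfolding normal_form_def by blast
  then show ?thesis unfolding normal_form_def by (intro exI[of _ C]) (simp add: assms(2))
qed

lemma normal_form_add:
  assumes "normal_form m D1" "normal_form m D2"
  shows "normal_form m (\<lambda>g. D1 g + D2 g)"
proof -
  obtain C1 C2 where "\<forall>I. C1 I \<in> S" "\<forall>g\<in>S. D1 g = (\<Sum>I\<in>indices m. C1 I \<odot> monomial I g)"
    "\<forall>I. C2 I \<in> S" "\<forall>g\<in>S. D2 g = (\<Sum>I\<in>indices m. C2 I \<odot> monomial I g)"
    using assms unfolding normal_form_def by blast
  then show ?thesis unfolding normal_form_def
    by (intro exI[of _ "\<lambda>I. C1 I + C2 I"])
      (simp add: superfunctions_add smult_add_left sum.distrib)
qed

lemma normal_form_smult:
  assumes "normal_form m D" "h \<in> S"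
  shows "normal_form m (\<lambda>g. h \<odot> D g)"
proof -
  obtain C where "\<forall>I. C I \<in> S" "\<forall>g\<in>S. D g = (\<Sum>I\<in>indices m. C I \<odot> monomial I g)"
    using assms unfolding normal_form_def by blast
  then show ?thesis unfolding normal_form_def using assms(2)
    by (intro exI[of _ "\<lambda>I. h \<odot> C I"])
      (simp add: superfunctions_smult smult_assoc smult_sum_right)
qed

lemma normal_form_sscale:
  assumes "normal_form m D"
  shows "normal_form m (\<lambda>g. sscale c (D g))"
proof -
  obtain C where "\<forall>I. C I \<in> S" "\<forall>g\<in>S. D g = (\<Sum>I\<in>indices m. C I \<odot> monomial I g)"
    using assms unfolding normal_form_def by blast
  then show ?thesis unfolding normal_form_def
    by (intro exI[of _ "\<lambda>I. sscale c (C I)"])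
      (simp add: superfunctions_sscale smult_sscale_left sscale_sum)
qed

lemma normal_form_zero: "normal_form m (\<lambda>g. 0)"
  unfolding normal_form_def by (intro exI[of _ "\<lambda>I. 0"]) (simp add: superfunctions_zero)

lemma normal_form_sum:
  assumes "finite X" "\<And>x. x \<in> X \<Longrightarrow> normal_form m (D x)"
  shows "normal_form m (\<lambda>g. \<Sum>x\<in>X. D x g)"
  using assms
proof (induction X rule: finite_induct)
  case empty
  show "normal_form m (\<lambda>g. \<Sum>x\<in>{}. D x g)" by (rule normal_form_cong[OF normal_form_zero]) simp
next
  case (insert x X)
  have "normal_form m (\<lambda>g. \<Sum>x\<in>X. D x g)" using insert by blast
  with insert.prems have "normal_form m (\<lambda>g. D x g + (\<Sum>x\<in>X. D x g))"
    by (intro normal_form_add) auto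
  then show "normal_form m (\<lambda>g. \<Sum>x\<in>insert x X. D x g)"
    by (rule normal_form_cong) (rule sum.insert[OF insert.hyps])
qed

lemma normal_form_mono:
  assumes "normal_form m D" "m \<le> m'"
  shows "normal_form m' D"
proof -
  obtain C where C: "\<forall>I. C I \<in> S" "\<forall>g\<in>S. D g = (\<Sum>I\<in>indices m. C I \<odot> monomial I g)"
    using assms unfolding normal_form_def by blast
  define C' where "C' I = (if I \<in> indices m then C I else 0)" for I
  have "(\<Sum>I\<in>indices m'. C' I \<odot> monomial I g) = (\<Sum>I\<in>indices m. C' I \<odot> monomial I g)" for g
    using assms(2) by (intro sum.mono_neutral_right finite_indices) (auto simp: indices_def C'_def)
  moreover have "(\<Sum>I\<in>indices m. C' I \<odot> monomial I g) = (\<Sum>I\<in>indices m. C I \<odot> monomial I g)" for g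
    by (rule sum.cong) (simp_all add: C'_def)
  ultimately show ?thesis unfolding normal_form_def
    using C by (intro exI[of _ C']) (auto simp: C'_def superfunctions_zero)
qed

lemma normal_form_monomial:
  assumes "I \<in> indices m"
  shows "normal_form m (monomial I)"
proof -
  define C :: "(nat \<Rightarrow> nat) \<Rightarrow> sfun" where "C J = (if J = I then sone else 0)" for J
  have "monomial I g = (\<Sum>J\<in>indices m. C J \<odot> monomial J g)" if "g \<in> S" for g
  proof -
    have "(\<Sum>J\<in>indices m. C J \<odot> monomial J g) = (\<Sum>J\<in>{I}. C J \<odot> monomial J g)"
      using assms finite_indices by (intro sum.mono_neutral_right) (auto simp: C_def)
    then show ?thesis using that by (simp add: C_def sone_smult[where l = l and n = n] monomial_closed)
  qed
  then show ?thesis unfolding normal_form_def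
    by (intro exI[of _ C]) (auto simp: C_def superfunctions_zero superfunctions_sone)
qed

lemma sorted_concat_replicate: "sorted xs \<Longrightarrow> sorted (concat (map (\<lambda>A. replicate (I A) A) xs))"
  by (induction xs) (auto simp: sorted_append)

lemma mset_index_word:
  assumes "set ws \<subseteq> {..2 * l + n}"
  shows "mset (index_word (count (mset ws))) = mset ws"
proof (rule multiset_eqI)
  fix B
  have *: "count (mset (concat (map (\<lambda>A. replicate (I A) A) xs))) B = (if B \<in> set xs then I B else 0)"
    if "distinct xs" for xs and I :: "nat \<Rightarrow> nat"
    using that by (induction xs) auto
  show "count (mset (index_word (count (mset ws)))) B = count (mset ws) B"
    using assms unfolding index_word_def by (subst *) (auto simp: not_le count_eq_zero_iff)
qed

lemma sort_eq_index_word: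
  assumes "set ws \<subseteq> {..2 * l + n}"
  shows "sort ws = index_word (count (mset ws))"
proof (rule properties_for_sort[OF mset_index_word[OF assms]])
  show "sorted (index_word (count (mset ws)))"
    unfolding index_word_def by (rule sorted_concat_replicate[OF sorted_upt])
qed

text \<open>
  A word is sorted by adjacent transpositions; each of them leaves a correction term whose word is
  shorter and of no larger weight. A repeated odd letter is removed by \<open>G\<^sub>A\<^sup>2 = (b\<^sub>A\<^sub>A/2) G\<^sub>0\<close>.
\<close>

lemma normal_form_word:
  assumes "set ws \<subseteq> {..2 * l + n}"
  shows "normal_form (word_weight ws) (word ws)"
  using assms
\<comment> \<open>The measure is the length because the weight need not drop: in the contact frame,
  two letters of weight 1 may be replaced by one letter of weight 2.\<close>
proof (induction "length ws" arbitrary: ws rule: less_induct)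
  case less
  note set_ws = less.prems
  have shorter: "normal_form (word_weight ws) (\<lambda>g. sscale c (word (u @ 0 # v) g))"
    if m: "mset (u @ A # B # v) = mset ws" and c: "c \<noteq> 0 \<Longrightarrow> b A B \<noteq> 0" for u v A B c
  proof (cases "c = 0")
    case True
    then show ?thesis using normal_form_zero by simp
  next
    case False
    have s: "set (u @ A # B # v) = set ws" by (rule mset_eq_setD[OF m])
    have "length (u @ A # B # v) = length ws" by (rule mset_eq_length[OF m])
    then have "length (u @ 0 # v) < length ws" by simp
    moreover have "set (u @ 0 # v) \<subseteq> {..2 * l + n}" using s set_ws by auto
    ultimately have "normal_form (word_weight (u @ 0 # v)) (word (u @ 0 # v))" by (rule less.hyps)
    moreover have "word_weight (u @ 0 # v) \<le> word_weight (u @ A # B # v)"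
      using w_commute[of A B] c[OF False] s set_ws by (auto simp: word_weight_append word_weight_Cons)
    ultimately show ?thesis
      using word_weight_mset[OF m] by (metis normal_form_mono normal_form_sscale)
  qed
  have swap: "normal_form (word_weight ws) (word (u @ A # B # v))"
    if m: "mset (u @ A # B # v) = mset ws" and nf: "normal_form (word_weight ws) (word (u @ B # A # v))" for u v A B
  proof (rule normal_form_cong[OF normal_form_add[OF normal_form_sscale[OF nf] shorter[OF m]]])
    fix g assume g: "g \<in> S"
    have AB: "A \<le> 2 * l + n" "B \<le> 2 * l + n" and u: "set u \<subseteq> {..2 * l + n}" and v: "set v \<subseteq> {..2 * l + n}"
      using mset_eq_setD[OF m] set_ws by auto
    have v': "word v g \<in> S" using v g by (rule word_closed)
    show "word (u @ A # B # v) g = sscale ((-1) ^ (par l A * par l B)) (word (u @ B # A # v) g)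
        + sscale (b A B) (word (u @ 0 # v) g)"
      using AB u v' by (simp add: word_append G_commute[OF AB v'] word_linear G_closed)
  qed
  \<comment> \<open>A letter \<open>B\<close> smaller than \<open>A\<close> joins the prefix, the
    induction hypothesis inserts \<open>A\<close> behind it, and \<open>swap\<close> then exchanges
    the two.\<close>
  have insort: "normal_form (word_weight ws) (word (u @ A # v))"
    if "mset (u @ A # v) = mset ws" "normal_form (word_weight ws) (word (u @ insort A v))" for u A v
    using that
  proof (induction v arbitrary: u)
    case (Cons B v)
    show ?case
    proof (cases "A \<le> B")
      case True
      then show ?thesis using Cons.prems by simp
    next
      case False
      have m: "mset ((u @ [B]) @ A # v) = mset ws"
        by (rule trans[OF _ Cons.prems(1)]) (simp add: add_mset_commute)
      have "normal_form (word_weight ws) (word ((u @ [B]) @ insort A v))"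
        using Cons.prems(2) False by simp
      with m have "normal_form (word_weight ws) (word ((u @ [B]) @ A # v))" by (rule Cons.IH)
      then have "normal_form (word_weight ws) (word (u @ B # A # v))" by simp
      with Cons.prems(1) show ?thesis by (rule swap)
    qed
  qed simp
  have sort: "normal_form (word_weight ws) (word (u @ v))"
    if "mset (u @ v) = mset ws" "normal_form (word_weight ws) (word (u @ sort v))" for u v
    using that
  proof (induction v arbitrary: u)
    case (Cons A v)
    have "normal_form (word_weight ws) (word (u @ A # sort v))"
      using Cons.prems by (intro insort) simp_all
    then show ?case using Cons.IH[of "u @ [A]"] Cons.prems by simp
  qed simp
  define I where "I = count (mset ws)"
  have sort_ws: "sort ws = index_word I" unfolding I_def using set_ws by (rule sort_eq_index_word)
  have "normal_form (word_weight ws) (word (index_word I))"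
  proof (cases "\<exists>A>2 * l. I A \<ge> 2")
    case True
    then obtain A where A: "2 * l < A" "I A \<ge> 2" by blast
    have "A \<in># mset ws"
    proof (rule ccontr)
      assume "A \<notin># mset ws"
      then have "I A = 0" unfolding I_def by (rule not_in_iff[THEN iffD1])
      with A(2) show False by simp
    qed
    then have "A \<in> set ws" by simp
    then have A': "A \<le> 2 * l + n" using set_ws by auto
    then have "A \<in> set [0..<2 * l + n + 1]" by auto
    from split_list[OF this] obtain xs ys where xs: "[0..<2 * l + n + 1] = xs @ A # ys"
      by blast
    obtain k where "I A = 2 + k" using A(2) le_Suc_ex by blast
    then have "replicate (I A) A = A # A # replicate k A" by (simp add: numeral_2_eq_2)
    then obtain u v where uv: "index_word I = u @ A # A # v"
      unfolding index_word_def xs by simp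
    have m: "mset (u @ A # A # v) = mset ws" using uv sort_ws by (metis mset_sort)
    have "normal_form (word_weight ws) (\<lambda>g. sscale (b A A / 2) (word (u @ 0 # v) g))"
      by (rule shorter[OF m]) auto
    then show ?thesis
    proof (rule normal_form_cong)
      fix g assume g: "g \<in> S"
      have u: "set u \<subseteq> {..2 * l + n}" and v: "set v \<subseteq> {..2 * l + n}"
        using mset_eq_setD[OF m] set_ws by auto
      define h where "h = word v g"
      have h: "h \<in> S" unfolding h_def using v g by (rule word_closed)
      have "par l A * par l A = 1" using A(1) by (simp add: par_def)
      then have "G A (G A h) = - G A (G A h) + sscale (b A A) (G 0 h)"
        using G_commute[OF A' A' h] by (simp add: sscale_minus_one)
      then have "G A (G A h) + G A (G A h) = sscale (b A A) (G 0 h)" by (simp add: algebra_simps)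
      then have "sscale (1/2) (G A (G A h) + G A (G A h)) = sscale (b A A / 2) (G 0 h)" by simp
      moreover have "sscale (1/2) (x + x) = x" for x by (simp add: sscale_def fun_eq_iff)
      \<comment> \<open>The zero summand produces the two-term shape of
        \<open>word_linear\<close>.\<close>
      ultimately have "G A (G A h) = sscale (b A A / 2) (G 0 h) + sscale 0 (G 0 h)" by simp
      then have "word u (G A (G A h)) = sscale (b A A / 2) (word u (G 0 h))"
        using word_linear[OF u, of "G 0 h" "G 0 h" "b A A / 2" 0] h by (simp add: G_closed)
      then show "word (index_word I) g = sscale (b A A / 2) (word (u @ 0 # v) g)"
        by (simp add: uv word_append h_def)
    qed
  next
    case False
    have "I \<in> multi_indices l n"
      unfolding multi_indices_def
    proof (intro CollectI conjI allI impI)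
      show "I A \<le> 1" if "2 * l < A" for A using False that by fastforce
      show "I A = 0" if "2 * l + n < A" for A
        using set_ws that unfolding I_def by (intro not_in_iff[THEN iffD1]) auto
    qed
    moreover have "index_weight I = word_weight ws"
      unfolding word_weight_index_word[symmetric] by (rule word_weight_mset) (metis sort_ws mset_sort)
    ultimately have "normal_form (word_weight ws) (monomial I)"
      by (intro normal_form_monomial) (simp add: indices_def)
    then show ?thesis by (rule normal_form_cong) (simp add: monomial_eq_word)
  qed
  then show ?case using sort[of "[]" ws] sort_ws by simp
qed

text \<open>By the Leibniz rule the derivative either hits a coefficient and leaves the monomial, or
  it prepends the letter \<open>A\<close> to a sorted word. The longer word may be unsorted;
  \<open>normal_form_word\<close> sorts it within weight \<open>m + w A\<close>.\<close>

lemma normal_form_der: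
  assumes A: "A \<le> 2 * l + n" and "normal_form m D"
  shows "normal_form (m + w A) (\<lambda>g. G A (D g))"
proof -
  obtain C where C: "\<forall>I. C I \<in> S" "\<forall>g\<in>S. D g = (\<Sum>I\<in>indices m. C I \<odot> monomial I g)"
    using assms unfolding normal_form_def by blast
  have "normal_form (m + w A) (\<lambda>g. \<Sum>I\<in>indices m.
      G A (C I) \<odot> monomial I g + parity_twist (par l A) (C I) \<odot> word (A # index_word I) g)"
  proof (intro normal_form_sum finite_indices normal_form_add normal_form_smult)
    fix I assume I: "I \<in> indices m"
    then show "normal_form (m + w A) (monomial I)"
      by (intro normal_form_monomial) (simp add: indices_def)
    have "normal_form (word_weight (A # index_word I)) (word (A # index_word I))"
      using A set_index_word by (intro normal_form_word) simp
    then show "normal_form (m + w A) (word (A # index_word I))"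
      by (rule normal_form_mono) (use I in \<open>simp add: word_weight_Cons word_weight_index_word indices_def\<close>)
  qed (use A C in \<open>auto intro: G_closed superfunctions_twist\<close>)
  then show ?thesis
  proof (rule normal_form_cong)
    fix g assume g: "g \<in> S"
    have "G A (D g) = (\<Sum>I\<in>indices m. G A (C I \<odot> monomial I g))"
      using C g A by (simp add: G_sum finite_indices superfunctions_smult monomial_closed)
    then show "G A (D g) = (\<Sum>I\<in>indices m.
      G A (C I) \<odot> monomial I g + parity_twist (par l A) (C I) \<odot> word (A # index_word I) g)"
      using A C g by (simp add: G_smult monomial_closed monomial_eq_word word_closed set_index_word)
  qed
qed

section \<open>Generated operators and their normal forms\<close>

lemma ops_closed: "ops m D \<Longrightarrow> g \<in> S \<Longrightarrow> D g \<in> S"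
proof (induction rule: ops.induct)
  case (ident D m)
  show "D g \<in> S" unfolding ident.hyps[OF ident.prems] by (rule ident.prems)
next
  case (add m D1 D2 D)
  show "D g \<in> S" unfolding add.hyps(3)[OF add.prems] by (intro superfunctions_add add.IH add.prems)
next
  case (smult h m D1 D)
  show "D g \<in> S"
    unfolding smult.hyps(3)[OF smult.prems] by (intro superfunctions_smult smult.hyps(1) smult.IH smult.prems)
next
  case (der A m D1 m' D)
  show "D g \<in> S"
    unfolding der.hyps(4)[OF der.prems] by (intro G_closed der.hyps(1) der.IH der.prems)
qed

lemma ops_additive:
  assumes "ops m D" "g \<in> S" "h \<in> S" shows "D (g + h) = D g + D h"
  using assms
proof (induction rule: ops.induct)
  case (ident D m)
  show "D (g + h) = D g + D h"
    using ident.prems by (simp only: ident.hyps superfunctions_add)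
next
  case (add m D1 D2 D)
  have "D1 (g + h) = D1 g + D1 h" "D2 (g + h) = D2 g + D2 h" by (rule add.IH; fact add.prems)+
  then show "D (g + h) = D g + D h"
    using add.prems by (simp add: add.hyps(3) superfunctions_add)
next
  case (smult k m D1 D)
  have "D1 (g + h) = D1 g + D1 h" by (rule smult.IH; fact smult.prems)
  then show "D (g + h) = D g + D h"
    using smult.prems by (simp add: smult.hyps(3) superfunctions_add smult_add_right)
next
  case (der A m D1 m' D)
  have "D1 (g + h) = D1 g + D1 h" by (rule der.IH; fact der.prems)
  then show "D (g + h) = D g + D h"
    using der.prems by (simp add: der.hyps(1,4) superfunctions_add G_add ops_closed[OF der.hyps(2)])
qed

lemma ops_mono: "ops m D \<Longrightarrow> m \<le> m' \<Longrightarrow> ops m' D"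
proof (induction arbitrary: m' rule: ops.induct)
  case (ident D m)
  show ?case by (rule ops.ident[OF ident.hyps])
next
  case (add m D1 D2 D)
  show ?case by (rule ops.add[OF add.IH(1)[OF add.prems] add.IH(2)[OF add.prems] add.hyps(3)])
next
  case (smult h m D1 D)
  show ?case by (rule ops.smult[OF smult.hyps(1) smult.IH[OF smult.prems] smult.hyps(3)])
next
  case (der A m D1 m1 D)
  show ?case
    by (rule ops.der[OF der.hyps(1,2) order_trans[OF der.hyps(3) der.prems] der.hyps(4)])
qed

text \<open>Each rule of \<open>ops\<close> carries its own equation on superfunctions, so
  multiplication by the unit exchanges the representative.\<close>

lemma ops_cong:
  assumes "ops m D1" "\<And>g. g \<in> S \<Longrightarrow> D g = D1 g"
  shows "ops m D"
  by (rule ops.smult[OF superfunctions_sone assms(1)])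
    (simp add: assms(2) sone_smult[OF ops_closed[OF assms(1)]])

lemma ops_const: "h \<in> S \<Longrightarrow> ops m (\<lambda>g. h \<odot> g)"
  by (rule ops.smult[OF _ ops.ident[of "\<lambda>g. g", OF refl] refl])

lemma ops_zero: "ops m (\<lambda>g. 0)"
  by (rule ops_cong[OF ops_const[OF superfunctions_zero]]) simp

lemma ops_sscale:
  assumes "ops m D" shows "ops m (\<lambda>g. sscale c (D g))"
proof (rule ops.smult[OF superfunctions_sscale[OF superfunctions_sone] assms])
  fix g assume "g \<in> S"
  then show "sscale c (D g) = sscale c sone \<odot> D g"
    by (simp add: smult_sscale_left sone_smult[OF ops_closed[OF assms]])
qed

lemma ops_sum:
  assumes "finite X" "\<And>x. x \<in> X \<Longrightarrow> ops m (D x)"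
  shows "ops m (\<lambda>g. \<Sum>x\<in>X. D x g)"
  using assms
proof (induction X rule: finite_induct)
  case empty
  show "ops m (\<lambda>g. \<Sum>x\<in>{}. D x g)" by (rule ops_cong[OF ops_zero]) simp
next
  case (insert x X)
  have "ops m (\<lambda>g. \<Sum>x\<in>X. D x g)" using insert by blast
  moreover have "ops m (D x)" using insert.prems by simp
  ultimately show "ops m (\<lambda>g. \<Sum>x\<in>insert x X. D x g)"
    by (rule ops.add[OF _ _ sum.insert[OF insert.hyps], rotated])
qed

lemma ops_word: "set ws \<subseteq> {..2 * l + n} \<Longrightarrow> word_weight ws \<le> m \<Longrightarrow> ops m (word ws)"
proof (induction ws arbitrary: m)
  case Nil
  show ?case by (rule ops.ident) simp
next
  case (Cons A ws)
  show ?case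
    by (rule ops.der[of A "word_weight ws" "word ws"]) (use Cons in \<open>auto simp: word_weight_Cons\<close>)
qed

text \<open>A spanning statement of Poincare-Birkhoff-Witt type. The commutation relations enter
  from left to right, through \<open>normal_form_der\<close>; conversely, monomials are themselves
  words in the fields.\<close>

lemma ops_iff_normal_form: "ops m D \<longleftrightarrow> normal_form m D"
proof
  show "ops m D \<Longrightarrow> normal_form m D"
  proof (induction rule: ops.induct)
    case (ident D m)
    have "normal_form m (word [])"
      by (rule normal_form_mono[OF normal_form_word]) (simp_all add: word_weight_def)
    then show ?case by (rule normal_form_cong) (simp add: ident)
  next
    case (add m D1 D2 D)
    show ?case by (rule normal_form_cong[OF normal_form_add[OF add.IH] add.hyps(3)])
  next
    case (smult h m D1 D)
    show ?case by (rule normal_form_cong[OF normal_form_smult[OF smult.IH smult.hyps(1)] smult.hyps(3)])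
  next
    case (der A m D1 m' D)
    show ?case
      by (rule normal_form_cong[OF normal_form_mono[OF normal_form_der[OF der.hyps(1) der.IH] der.hyps(3)] der.hyps(4)])
  qed
next
  assume "normal_form m D"
  then obtain C where C: "\<forall>I. C I \<in> S" "\<forall>g\<in>S. D g = (\<Sum>I\<in>indices m. C I \<odot> monomial I g)"
    unfolding normal_form_def by blast
  have "ops m (\<lambda>g. \<Sum>I\<in>indices m. C I \<odot> monomial I g)"
  proof (intro ops_sum finite_indices)
    fix I assume "I \<in> indices m"
    then have I: "ops m (word (index_word I))"
      by (intro ops_word set_index_word) (simp add: word_weight_index_word indices_def)
    show "ops m (\<lambda>g. C I \<odot> monomial I g)"
      by (rule ops.smult[OF spec[OF C(1)] I]) (simp only: monomial_eq_word)
  qed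
  then show "ops m D" by (rule ops_cong) (use C in blast)
qed

text \<open>
  If \<open>D\<close> is homogeneous of parity \<open>b\<close>, then conjugation by \<open>parity_twist a\<close> multiplies it by \<open>(-1)\<^bsup>ab\<^esup>\<close>,
  so the operator below is the supercommutator; in this form \<open>D\<close> need not be split into homogeneous parts.
\<close>

lemma twisted_commutator_ops:
  assumes L2_closed: "\<And>g. g \<in> S \<Longrightarrow> L2 g \<in> S"
    and L1_add: "\<And>g h. g \<in> S \<Longrightarrow> h \<in> S \<Longrightarrow> L1 (g + h) = L1 g + L1 h"
    and L12: "\<phi> \<in> S" "\<And>g. g \<in> S \<Longrightarrow> L1 g = L2 g + \<phi> \<odot> g"
    and Leibniz: "\<And>h. h \<in> S \<Longrightarrow> \<delta> h \<in> S"
      "\<And>h g. h \<in> S \<Longrightarrow> g \<in> S \<Longrightarrow> L1 (h \<odot> g) = \<delta> h \<odot> g + parity_twist a h \<odot> L1 g"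
    and comm: "\<And>A B. A \<le> 2 * l + n \<Longrightarrow> B \<le> 2 * l + n \<Longrightarrow> \<kappa> A B \<in> S"
      "\<And>A B. A \<le> 2 * l + n \<Longrightarrow> B \<le> 2 * l + n \<Longrightarrow> \<kappa> A B \<noteq> 0 \<Longrightarrow> w B \<le> w A"
      "\<And>A. A \<le> 2 * l + n \<Longrightarrow> e A \<in> S"
      "\<And>A g. A \<le> 2 * l + n \<Longrightarrow> g \<in> S \<Longrightarrow> L1 (G A g) = sscale ((-1) ^ (a * par l A)) (G A (L1 g))
          + (\<Sum>B\<in>{..2 * l + n}. \<kappa> A B \<odot> G B g) + e A \<odot> g"
    and D: "ops m D"
  shows "ops m (\<lambda>g. L1 (D g) - parity_twist a (D (parity_twist a (L2 g))))"
  using D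
proof (induction rule: ops.induct)
  \<comment> \<open>On the identity the two twists cancel, leaving \<open>L1 - L2\<close>, which is
    multiplication by \<phi>.\<close>
  case (ident D m)
  show ?case
    by (rule ops_cong[OF ops_const[OF L12(1)]])
      (simp add: ident L2_closed superfunctions_twist L12(2))
next
  case (add m D1 D2 D)
  have "L1 (D g) - parity_twist a (D (parity_twist a (L2 g)))
      = (L1 (D1 g) - parity_twist a (D1 (parity_twist a (L2 g))))
        + (L1 (D2 g) - parity_twist a (D2 (parity_twist a (L2 g))))" if g: "g \<in> S" for g
  proof -
    have "parity_twist a (L2 g) \<in> S" using g by (intro superfunctions_twist L2_closed)
    then show ?thesis
      by (simp only: add.hyps(3) g L1_add[OF ops_closed[OF add.hyps(1) g] ops_closed[OF add.hyps(2) g]]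
          parity_twist_add add_diff_add)
  qed
  then show ?case by (rule ops.add[OF add.IH])
next
  case (smult h m D1 D)
  have "L1 (D g) - parity_twist a (D (parity_twist a (L2 g)))
      = \<delta> h \<odot> D1 g + parity_twist a h \<odot> (L1 (D1 g) - parity_twist a (D1 (parity_twist a (L2 g))))"
    if g: "g \<in> S" for g
  proof -
    have "parity_twist a (L2 g) \<in> S" using g by (intro superfunctions_twist L2_closed)
    then show ?thesis
      by (simp only: smult.hyps(3) g Leibniz(2)[OF smult.hyps(1) ops_closed[OF smult.hyps(2) g]]
          parity_twist_smult diff_eq_sscale smult_add_right smult_sscale_right add.assoc)
  qed
  then show ?case
    by (rule ops.add[OF ops.smult[OF Leibniz(1)[OF smult.hyps(1)] smult.hyps(2) refl]
          ops.smult[OF superfunctions_twist[OF smult.hyps(1)] smult.IH refl]])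
next
  case (der A m D1 m' D)
  define s where "s = (-1::real) ^ (a * par l A)"
  define E where "E = (\<lambda>g. L1 (D1 g) - parity_twist a (D1 (parity_twist a (L2 g))))"
  have E: "ops m E" unfolding E_def by (rule der.IH)
  \<comment> \<open>This is where the degree is kept: \<open>G A\<close> is traded for
    \<open>G B\<close>, and \<open>w B \<le> w A\<close> whenever the coefficient is
    nonzero.\<close>
  have "ops m' (\<lambda>g. \<kappa> A B \<odot> G B (D1 g))" if "B \<le> 2 * l + n" for B
  proof (cases "\<kappa> A B = 0")
    case True
    then show ?thesis using ops_zero by simp
  next
    case False
    have "ops m' (\<lambda>g. G B (D1 g))"
      by (rule ops.der[OF that der.hyps(2) _ refl]) (use comm(2)[OF der.hyps(1) that False] der.hyps(3) in simp)
    then show ?thesis by (rule ops.smult[OF comm(1)[OF der.hyps(1) that] _ refl])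
  qed
  then have 1: "ops m' (\<lambda>g. \<Sum>B\<in>{..2 * l + n}. \<kappa> A B \<odot> G B (D1 g))"
    by (intro ops_sum) auto
  have 2: "ops m' (\<lambda>g. e A \<odot> D1 g)"
    using der.hyps(3) by (intro ops.smult[OF comm(3)[OF der.hyps(1)] ops_mono[OF der.hyps(2)] refl]) simp
  have 3: "ops m' (\<lambda>g. sscale s (G A (E g)))"
    by (rule ops_sscale[OF ops.der[OF der.hyps(1) E der.hyps(3) refl]])
  show ?case
  proof (rule ops.add[OF 3 ops.add[OF 1 2 refl]])
    fix g assume g: "g \<in> S"
    have Lg: "parity_twist a (L2 g) \<in> S" using g by (intro superfunctions_twist L2_closed)
    define x where "x = D1 (parity_twist a (L2 g))"
    have x: "x \<in> S" unfolding x_def by (rule ops_closed[OF der.hyps(2) Lg])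
    have y: "D1 g \<in> S" by (rule ops_closed[OF der.hyps(2) g])
    have "L1 (D1 g) \<in> S"
      using y by (simp add: L12 L2_closed superfunctions_add superfunctions_smult)
    moreover have "E g = L1 (D1 g) + sscale (-1) (parity_twist a x)"
      unfolding E_def x_def by (rule diff_eq_sscale)
    ultimately have "G A (E g) = G A (L1 (D1 g)) + sscale (-1) (G A (parity_twist a x))"
      using der.hyps(1) x by (simp add: G_add G_sscale superfunctions_sscale superfunctions_twist)
    then have "sscale s (G A (E g))
        = sscale s (G A (L1 (D1 g))) + sscale (-1) (sscale s (G A (parity_twist a x)))"
      by (simp add: sscale_add)
    \<comment> \<open>\<open>G_twist\<close> contributes a second factor \<open>s\<close>, which
      cancels the first.\<close>
    moreover have "sscale s (G A (parity_twist a x)) = parity_twist a (G A x)"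
      unfolding G_twist[OF der.hyps(1) x, of a] by (simp add: s_def power_add[symmetric])
    ultimately have "sscale s (G A (E g)) = sscale s (G A (L1 (D1 g))) - parity_twist a (G A x)"
      by (simp only: diff_eq_sscale)
    then show "L1 (D g) - parity_twist a (D (parity_twist a (L2 g))) = sscale s (G A (E g))
        + ((\<Sum>B\<in>{..2 * l + n}. \<kappa> A B \<odot> G B (D1 g)) + e A \<odot> D1 g)"
      using comm(4)[OF der.hyps(1) y]
      unfolding der.hyps(4)[OF g] der.hyps(4)[OF Lg] x_def[symmetric] s_def[symmetric] by simp
  qed
qed

end

section \<open>Vector fields and Lie derivatives in a frame\<close>

context frame
begin

definition vector_field :: "(nat \<Rightarrow> sfun) \<Rightarrow> sfun \<Rightarrow> sfun" where
  "vector_field c g = (\<Sum>A\<in>{..2 * l + n}. c A \<odot> G A g)"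

lemma vector_field_closed:
  assumes "\<And>A. A \<le> 2 * l + n \<Longrightarrow> c A \<in> S" "g \<in> S"
  shows "vector_field c g \<in> S"
  unfolding vector_field_def using assms
  by (intro superfunctions_sum superfunctions_smult G_closed) auto

lemma vector_field_add:
  assumes "g \<in> S" "h \<in> S"
  shows "vector_field c (g + h) = vector_field c g + vector_field c h"
proof -
  have "vector_field c (g + h) = (\<Sum>A\<in>{..2 * l + n}. c A \<odot> G A g + c A \<odot> G A h)"
    unfolding vector_field_def
    by (rule sum.cong[OF refl]) (use assms in \<open>simp add: G_add smult_add_right\<close>)
  then show ?thesis by (simp only: vector_field_def sum.distrib)
qed

text \<open>Each \<open>c A\<close> has parity \<open>a + par l A\<close>, so moving it past a
  function twisted by \<open>par l A\<close> leaves a twist by \<open>a\<close>: the field as a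
  whole has parity \<open>a\<close>.\<close>

lemma vector_field_smult:
  assumes c: "\<And>A. A \<le> 2 * l + n \<Longrightarrow> homogeneous (a + par l A) (c A)"
    and "h \<in> S" "g \<in> S"
  shows "vector_field c (h \<odot> g) = vector_field c h \<odot> g + parity_twist a h \<odot> vector_field c g"
proof -
  have "vector_field c (h \<odot> g) = (\<Sum>A\<in>{..2 * l + n}. (c A \<odot> G A h) \<odot> g + parity_twist a h \<odot> (c A \<odot> G A g))"
    unfolding vector_field_def
  proof (rule sum.cong[OF refl])
    fix A assume "A \<in> {..2 * l + n}"
    then have A: "A \<le> 2 * l + n" by simp
    have "c A \<odot> parity_twist (par l A) h = parity_twist a h \<odot> c A"
      using smult_supercommute[OF c[OF A]] by (simp add: parity_twist_twist)
    then have "c A \<odot> (parity_twist (par l A) h \<odot> G A g) = parity_twist a h \<odot> (c A \<odot> G A g)"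
      by (simp flip: smult_assoc)
    then show "c A \<odot> G A (h \<odot> g) = (c A \<odot> G A h) \<odot> g + parity_twist a h \<odot> (c A \<odot> G A g)"
      using A assms(2,3) by (simp only: G_smult smult_add_right smult_assoc)
  qed
  then show ?thesis
    by (simp only: vector_field_def sum.distrib smult_sum_left smult_sum_right)
qed

text \<open>The second-order terms of the two compositions agree up to the sign of the
  supercommutator. What remains are the derivatives of the coefficients, in all directions, and the
  structure constants, along \<open>G 0\<close> only.\<close>

lemma vector_field_commutator:
  assumes c: "\<And>B. B \<le> 2 * l + n \<Longrightarrow> c B \<in> S" "\<And>B. B \<le> 2 * l + n \<Longrightarrow> homogeneous (a + par l B) (c B)"
    and A: "A \<le> 2 * l + n" and g: "g \<in> S"
  defines "s \<equiv> (-1) ^ (a * par l A)"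
  shows "vector_field c (G A g) = sscale s (G A (vector_field c g))
    + (\<Sum>B\<in>{..2 * l + n}. sscale (- s) (G A (c B)) \<odot> G B g)
    + (\<Sum>B\<in>{..2 * l + n}. sscale (b B A) (c B)) \<odot> G 0 g"
proof -
  have "vector_field c (G A g) = (\<Sum>B\<in>{..2 * l + n}. sscale s (G A (c B \<odot> G B g))
      + sscale (- s) (G A (c B)) \<odot> G B g + sscale (b B A) (c B) \<odot> G 0 g)"
    unfolding vector_field_def
  proof (rule sum.cong[OF refl])
    fix B assume "B \<in> {..2 * l + n}"
    then have B: "B \<le> 2 * l + n" by simp
    \<comment> \<open>\<open>t\<close> is the sign of moving \<open>G A\<close> past
      \<open>c B\<close>; \<open>s * t\<close> is the sign of exchanging \<open>G A\<close> and
      \<open>G B\<close>, so the second-order terms match those of \<open>G_commute\<close>.\<close>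
    define t where "t = (-1::real) ^ (par l A * (a + par l B))"
    define X where "X = G A (c B) \<odot> G B g"
    define Y where "Y = c B \<odot> G A (G B g)"
    have st: "s * t = (-1) ^ (par l B * par l A)"
      unfolding s_def t_def by (auto simp: par_def power_add[symmetric] mult_2[symmetric] add.assoc[symmetric] power_mult)
    have "G A (c B \<odot> G B g) = X + parity_twist (par l A) (c B) \<odot> G A (G B g)"
      unfolding X_def by (rule G_smult[OF A c(1)[OF B] G_closed[OF B g]])
    then have "G A (c B \<odot> G B g) = X + sscale t Y"
      by (simp only: parity_twist_homogeneous[OF c(2)[OF B]] smult_sscale_left t_def Y_def)
    then have "sscale s (G A (c B \<odot> G B g)) + sscale (- s) X = sscale (s * t) Y"
      by (simp add: sscale_add) (simp add: fun_eq_iff sscale_def)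
    moreover have "c B \<odot> G B (G A g) = sscale (s * t) Y + sscale (b B A) (c B \<odot> G 0 g)"
      unfolding st G_commute[OF B A g] by (simp only: smult_add_right smult_sscale_right Y_def)
    ultimately show "c B \<odot> G B (G A g) = sscale s (G A (c B \<odot> G B g))
      + sscale (- s) (G A (c B)) \<odot> G B g + sscale (b B A) (c B) \<odot> G 0 g"
      by (simp only: smult_sscale_left X_def)
  qed
  moreover have "G A (vector_field c g) = (\<Sum>B\<in>{..2 * l + n}. G A (c B \<odot> G B g))"
    unfolding vector_field_def
    by (rule G_sum[OF A]) (use c g in \<open>auto intro: superfunctions_smult G_closed\<close>)
  ultimately show ?thesis
    by (simp only: sum.distrib sscale_sum smult_sum_left)
qed

text \<open>By \<open>w_le\<close> a correction term can outweigh \<open>G A\<close> only along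
  \<open>G 0\<close>, and only if \<open>w A < w 0\<close>. For these \<open>A\<close> the
  hypothesis \<open>contact\<close> says that the bracket of the field with \<open>G A\<close> has
  no component along \<open>G 0\<close>.\<close>

lemma Lie_derivative_ops:
  assumes c: "\<And>A. A \<le> 2 * l + n \<Longrightarrow> c A \<in> S" "\<And>A. A \<le> 2 * l + n \<Longrightarrow> homogeneous (a + par l A) (c A)"
    and \<phi>: "\<phi> \<in> S" "homogeneous a \<phi>"
    and L: "\<And>mu g. g \<in> S \<Longrightarrow> L mu g = vector_field c g + sscale mu (\<phi> \<odot> g)"
    and contact: "\<And>A. A \<le> 2 * l + n \<Longrightarrow> w A < w 0 \<Longrightarrow>
      (\<Sum>B\<in>{..2 * l + n}. sscale (b B A) (c B)) = sscale ((-1) ^ (a * par l A)) (G A (c 0))"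
    and D: "ops m D"
  shows "ops m (\<lambda>g. L mu (D g) - parity_twist a (D (parity_twist a (L lam g))))"
\<comment> \<open>\<open>\<kappa>\<close> lists the components of the bracket with
  \<open>G A\<close>, the structure constants being collected at \<open>B = 0\<close>;
  \<open>e\<close> comes from differentiating the density term, and the multiplier
  \<open>\<phi>\<close> of the rule is the difference of the two density terms.\<close>
proof (rule twisted_commutator_ops[where a = a and \<phi> = "sscale (mu - lam) \<phi>" and \<delta> = "vector_field c"
      and \<kappa> = "\<lambda>A B. sscale (- ((-1) ^ (a * par l A))) (G A (c B))
          + (if B = 0 then \<Sum>B\<in>{..2 * l + n}. sscale (b B A) (c B) else 0)"
      and e = "\<lambda>A. sscale (- (mu * (-1) ^ (a * par l A))) (G A \<phi>)"])
  show L_closed: "L lam g \<in> S" if "g \<in> S" for g lam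
    unfolding L[OF that] using that c(1) \<phi>(1)
    by (intro superfunctions_add vector_field_closed superfunctions_sscale superfunctions_smult)
  show "L mu (g + h) = L mu g + L mu h" if "g \<in> S" "h \<in> S" for g h
    using that by (simp add: L superfunctions_add vector_field_add smult_add_right sscale_add)
  show "L mu g = L lam g + sscale (mu - lam) \<phi> \<odot> g" if "g \<in> S" for g
    using that by (simp add: L smult_sscale_left add.assoc sscale_add_left[symmetric])
  show "L mu (h \<odot> g) = vector_field c h \<odot> g + parity_twist a h \<odot> L mu g" if "h \<in> S" "g \<in> S" for h g
  proof -
    have "\<phi> \<odot> (h \<odot> g) = parity_twist a h \<odot> (\<phi> \<odot> g)"
      using smult_supercommute[OF \<phi>(2), of h] by (simp flip: smult_assoc)
    then show ?thesis
      using that by (simp add: L superfunctions_smult vector_field_smult[OF c(2)] smult_add_right smult_sscale_right)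
  qed
  show "L mu (G A g) = sscale ((-1) ^ (a * par l A)) (G A (L mu g))
      + (\<Sum>B\<in>{..2 * l + n}. (sscale (- ((-1) ^ (a * par l A))) (G A (c B))
          + (if B = 0 then \<Sum>B\<in>{..2 * l + n}. sscale (b B A) (c B) else 0)) \<odot> G B g)
      + sscale (- (mu * (-1) ^ (a * par l A))) (G A \<phi>) \<odot> g"
    if A: "A \<le> 2 * l + n" and g: "g \<in> S" for A g
  proof -
    define s where "s = (-1::real) ^ (a * par l A)"
    define c0 where "c0 = (\<Sum>B\<in>{..2 * l + n}. sscale (b B A) (c B))"
    have ss: "s * s = 1" by (simp add: s_def power_add[symmetric])
    have vg: "vector_field c g \<in> S" and \<phi>g: "\<phi> \<odot> g \<in> S"
      using c(1) g \<phi>(1) by (auto intro: vector_field_closed superfunctions_smult)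
    have "G A (\<phi> \<odot> g) = G A \<phi> \<odot> g + sscale s (\<phi> \<odot> G A g)"
      unfolding G_smult[OF A \<phi>(1) g] parity_twist_homogeneous[OF \<phi>(2)]
      by (simp only: s_def smult_sscale_left mult.commute)
    then have "sscale s (G A (\<phi> \<odot> g)) = sscale s (G A \<phi> \<odot> g) + \<phi> \<odot> G A g"
      by (simp add: sscale_add ss)
    then have e: "sscale mu (\<phi> \<odot> G A g) = sscale s (sscale mu (G A (\<phi> \<odot> g))) + sscale (- (mu * s)) (G A \<phi>) \<odot> g"
      by (simp add: fun_eq_iff sscale_apply smult_sscale_left) (simp add: algebra_simps)
    have "G A (L mu g) = G A (vector_field c g) + sscale mu (G A (\<phi> \<odot> g))"
      unfolding L[OF g] using A vg \<phi>g by (simp add: G_add G_sscale superfunctions_sscale)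
    then have GL: "sscale s (G A (L mu g)) = sscale s (G A (vector_field c g)) + sscale s (sscale mu (G A (\<phi> \<odot> g)))"
      by (simp only: sscale_add)
    have "(\<Sum>B\<in>{..2 * l + n}. (if B = 0 then c0 else 0) \<odot> G B g)
        = (\<Sum>B\<in>{..2 * l + n}. if B = 0 then c0 \<odot> G 0 g else 0)"
      by (rule sum.cong) auto
    then have delta: "(\<Sum>B\<in>{..2 * l + n}. (if B = 0 then c0 else 0) \<odot> G B g) = c0 \<odot> G 0 g"
      by (simp only: sum.delta finite_atMost atMost_iff le0 if_True)
    have "L mu (G A g) = vector_field c (G A g) + sscale mu (\<phi> \<odot> G A g)"
      by (rule L[OF G_closed[OF A g]])
    also have "vector_field c (G A g) = sscale s (G A (vector_field c g))
        + (\<Sum>B\<in>{..2 * l + n}. sscale (- s) (G A (c B)) \<odot> G B g) + c0 \<odot> G 0 g"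
      unfolding s_def c0_def by (rule vector_field_commutator[OF c A g])
    finally show ?thesis
      unfolding s_def[symmetric] c0_def[symmetric]
      by (simp only: e GL smult_add_left sum.distrib delta) (simp only: ac_simps)
  qed
  show "w B \<le> w A" if A: "A \<le> 2 * l + n" and B: "B \<le> 2 * l + n"
    and nz: "sscale (- ((-1) ^ (a * par l A))) (G A (c B))
          + (if B = 0 then \<Sum>B\<in>{..2 * l + n}. sscale (b B A) (c B) else 0) \<noteq> 0" for A B
  proof (cases "B = 0")
    case True
    show ?thesis
    proof (rule ccontr)
      assume "\<not> w B \<le> w A"
      then have "w A < w 0" using True by simp
      then show False using nz True contact[OF A] by (simp flip: sscale_add_left)
    qed
  qed (use w_le A B in auto)
qed (use c(1) \<phi>(1) D in \<open>auto intro!: superfunctions_add superfunctions_sscale superfunctions_sum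
      superfunctions_zero vector_field_closed G_closed\<close>)

end

section \<open>The canonical and the contact frame\<close>

lemma frame_dq: "frame l n (dq l) (\<lambda>A. 1) (\<lambda>A B. 0)"
proof
  fix A a and f g :: sfun and c :: real
  show "dq l A (parity_twist a f) = sscale ((-1) ^ (a * par l A)) (parity_twist a (dq l A f))"
    if "f \<in> superfunctions l n"
    using that by (rule dq_twist)
  show "dq l A (f \<odot> g) = dq l A f \<odot> g + parity_twist (par l A) f \<odot> dq l A g"
    if "f \<in> superfunctions l n" "g \<in> superfunctions l n"
    using that by (rule dq_smult)
qed (auto intro: superfunctions_dq dq_add dq_sscale dq_commute)

interpretation canonical: frame l n "dq l" "\<lambda>A. 1" "\<lambda>A B. 0" for l n
  by (rule frame_dq)

text \<open>One formula for all contact fields: \<open>tau l A\<close> is the coefficient of the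
  derivative in \<open>z\<close>, and its value 0 at \<open>A = 0\<close> makes the field with index
  0 that derivative itself.\<close>

definition tau :: "nat \<Rightarrow> nat \<Rightarrow> sfun" where
  "tau l A = (if A = 0 then 0 else if A \<le> l then coord l (l + A)
     else if A \<le> 2 * l then sscale (-1) (coord l (A - l)) else sscale (-1) (coord l A))"

definition contact_frame :: "nat \<Rightarrow> nat \<Rightarrow> sfun \<Rightarrow> sfun" where
  "contact_frame l A f = dq l A f + tau l A \<odot> dq l 0 f"

text \<open>The constant derivatives of \<open>tau\<close>, see \<open>dq_tau\<close>.\<close>

definition dtau :: "nat \<Rightarrow> nat \<Rightarrow> nat \<Rightarrow> real" where
  "dtau l A B = (if B = 0 then 0 else if B \<le> l then of_bool (A = l + B)
     else if B \<le> 2 * l then - of_bool (A = B - l) else - of_bool (A = B))"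

text \<open>The structure constants of the contact frame. The nonzero ones are -2 for the fields of
  \<open>x\<close> and \<open>y\<close> with the same number, 2 in the reverse order, and -2 for an
  odd field with itself.\<close>

definition contact_bracket :: "nat \<Rightarrow> nat \<Rightarrow> nat \<Rightarrow> real" where
  "contact_bracket l A B = dtau l A B - (-1) ^ (par l A * par l B) * dtau l B A"

definition contact_weight :: "nat \<Rightarrow> nat" where
  "contact_weight A = (if A = 0 then 2 else 1)"

lemma contact_frame_0: "contact_frame l 0 = dq l 0"
  by (rule ext) (simp add: contact_frame_def tau_def)

lemma contact_frame_eq_Tvf: "0 < A \<Longrightarrow> contact_frame l A f = Tvf l A f"
  by (simp add: contact_frame_def tau_def Tvf_def smult_sscale_left diff_eq_sscale)

lemma tau_superfunctions: "A \<le> 2 * l + n \<Longrightarrow> tau l A \<in> superfunctions l n"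
  by (auto simp: tau_def intro!: superfunctions_zero superfunctions_sscale superfunctions_coord)

lemma homogeneous_tau: "homogeneous (par l A) (tau l A)"
proof -
  have "par l (l + A) = par l A" if "A \<le> l" using that by (simp add: par_def)
  moreover have "par l (A - l) = par l A" if "A \<le> 2 * l" using that by (simp add: par_def)
  ultimately show ?thesis
    using homogeneous_coord[of l "l + A"] homogeneous_coord[of l "A - l"] homogeneous_coord[of l A]
    by (auto simp: tau_def homogeneous_zero intro!: homogeneous_sscale)
qed

lemma dq_tau:
  assumes "A \<le> 2 * l + n" "B \<le> 2 * l + n"
  shows "dq l A (tau l B) = sscale (dtau l A B) sone"
proof -
  have z: "dq l A 0 = 0" using dq_sscale[OF superfunctions_zero, of l A 0] by simp
  have c: "dq l A (sscale x (coord l C)) = sscale (x * of_bool (A = C)) sone" if "C \<le> 2 * l + n" for x C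
    using dq_sscale[OF superfunctions_coord[OF that]] dq_coord[OF assms(1) that] by simp
  have d: "dq l A (coord l C) = sscale (of_bool (A = C)) sone" if "C \<le> 2 * l + n" for C
    using dq_coord[OF assms(1) that] by simp
  show ?thesis
    using assms(2) by (simp add: tau_def dtau_def z c d)
qed

lemma contact_frame_closed:
  "A \<le> 2 * l + n \<Longrightarrow> f \<in> superfunctions l n \<Longrightarrow> contact_frame l A f \<in> superfunctions l n"
  unfolding contact_frame_def
  by (intro superfunctions_add superfunctions_smult superfunctions_dq tau_superfunctions)

lemma frame_contact: "frame l n (contact_frame l) contact_weight (contact_bracket l)"
proof
  fix A assume A: "A \<le> 2 * l + n"
  let ?S = "superfunctions l n"
  show "contact_frame l A g \<in> ?S" if "g \<in> ?S" for g
    using A that by (rule contact_frame_closed)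
  show "contact_frame l A (g + h) = contact_frame l A g + contact_frame l A h" if "g \<in> ?S" "h \<in> ?S" for g h
    unfolding contact_frame_def dq_add[OF that] by (simp only: smult_add_right ac_simps)
  show "contact_frame l A (sscale c g) = sscale c (contact_frame l A g)" if "g \<in> ?S" for g c
    unfolding contact_frame_def dq_sscale[OF that] by (simp only: smult_sscale_right sscale_add)
  show "contact_frame l A (h \<odot> g) = contact_frame l A h \<odot> g + parity_twist (par l A) h \<odot> contact_frame l A g"
    if "h \<in> ?S" "g \<in> ?S" for h g
  proof -
    have "tau l A \<odot> (h \<odot> dq l 0 g) = parity_twist (par l A) h \<odot> (tau l A \<odot> dq l 0 g)"
      using smult_supercommute[OF homogeneous_tau, of l A h] by (simp flip: smult_assoc)
    then show ?thesis
      unfolding contact_frame_def dq_smult[OF that]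
      by (simp add: smult_add_right smult_add_left smult_assoc par_def add_ac)
  qed
  show "contact_frame l A (parity_twist a g) = sscale ((-1) ^ (a * par l A)) (parity_twist a (contact_frame l A g))"
    if "g \<in> ?S" for g a
  proof -
    have "parity_twist a (tau l A \<odot> dq l 0 g) = sscale ((-1) ^ (a * par l A)) (tau l A \<odot> parity_twist a (dq l 0 g))"
      by (simp only: parity_twist_smult parity_twist_homogeneous[OF homogeneous_tau] smult_sscale_left)
    then have "sscale ((-1) ^ (a * par l A)) (parity_twist a (tau l A \<odot> dq l 0 g)) = tau l A \<odot> parity_twist a (dq l 0 g)"
      by (simp add: power_add[symmetric])
    then show ?thesis
      unfolding contact_frame_def dq_twist[OF that] by (simp add: parity_twist_add sscale_add par_def)
  qed
  show "0 < contact_weight A" by (simp add: contact_weight_def)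
  fix B assume B: "B \<le> 2 * l + n"
  \<comment> \<open>Sharp for two fields of weight 1: they cost as much as the field along which
    their bracket points.\<close>
  show "contact_weight 0 \<le> contact_weight A + contact_weight B" by (simp add: contact_weight_def)
  show "contact_weight B \<le> contact_weight A" if "B \<noteq> 0" using that by (simp add: contact_weight_def)
  show "contact_frame l A (contact_frame l B g) = sscale ((-1) ^ (par l A * par l B)) (contact_frame l B (contact_frame l A g))
      + sscale (contact_bracket l A B) (contact_frame l 0 g)" if g: "g \<in> ?S" for g
  proof -
    \<comment> \<open>Apart from the \<open>dtau\<close> term, these terms are supersymmetric in
      \<open>A\<close> and \<open>B\<close>, singly or as a pair, so only the super-antisymmetrized
      \<open>dtau\<close> survives in the bracket.\<close>
    have expand: "contact_frame l A (contact_frame l B g) = dq l A (dq l B g) + sscale (dtau l A B) (dq l 0 g)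
        + sscale ((-1) ^ (par l A * par l B)) (tau l B \<odot> dq l A (dq l 0 g))
        + tau l A \<odot> dq l B (dq l 0 g) + tau l A \<odot> (tau l B \<odot> dq l 0 (dq l 0 g))"
      if A: "A \<le> 2 * l + n" and B: "B \<le> 2 * l + n" for A B
    proof -
      note S = superfunctions_dq[OF g] tau_superfunctions[OF B] superfunctions_smult[OF tau_superfunctions[OF B] superfunctions_dq[OF g]]
      have 1: "dq l A' (contact_frame l B g) = dq l A' (dq l B g) + sscale (dtau l A' B) (dq l 0 g)
          + sscale ((-1) ^ (par l A' * par l B)) (tau l B \<odot> dq l A' (dq l 0 g))" if "A' \<le> 2 * l + n" for A'
        unfolding contact_frame_def
        by (simp only: dq_add[OF S(1) S(3)] dq_smult[OF S(2) S(1)] dq_tau[OF that B]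
            parity_twist_homogeneous[OF homogeneous_tau] smult_sscale_left sone_smult[OF S(1)] add.assoc)
      have "dtau l 0 B = 0" by (auto simp: dtau_def)
      moreover have "dq l 0 (dq l B g) = dq l B (dq l 0 g)" using dq_commute[OF g, of 0 B] by (simp add: par_def)
      ultimately have 2: "dq l 0 (contact_frame l B g) = dq l B (dq l 0 g) + tau l B \<odot> dq l 0 (dq l 0 g)"
        unfolding 1[OF le0] by (simp add: par_def)
      show ?thesis
        unfolding contact_frame_def[of l A] 1[OF A] 2 by (simp only: smult_add_right add.assoc)
    qed
    define s where "s = (-1::real) ^ (par l A * par l B)"
    have ss: "s * s = 1" by (simp add: s_def power_add[symmetric])
    have "tau l A \<odot> tau l B = sscale s (tau l B \<odot> tau l A)"
      unfolding s_def smult_supercommute[OF homogeneous_tau, of l A "tau l B"]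
      by (simp only: parity_twist_homogeneous[OF homogeneous_tau] smult_sscale_left)
    then have t: "tau l A \<odot> (tau l B \<odot> x) = sscale s (tau l B \<odot> (tau l A \<odot> x))" for x
      by (metis smult_assoc smult_sscale_left)
    have d: "dq l A (dq l B g) = sscale s (dq l B (dq l A g))"
      unfolding s_def by (rule dq_commute[OF g])
    have s': "(-1) ^ (par l B * par l A) = s" by (simp add: s_def mult.commute)
    have "sscale s (contact_frame l B (contact_frame l A g)) = dq l A (dq l B g) + sscale (s * dtau l B A) (dq l 0 g)
        + tau l A \<odot> dq l B (dq l 0 g)
        + sscale s (tau l B \<odot> dq l A (dq l 0 g)) + tau l A \<odot> (tau l B \<odot> dq l 0 (dq l 0 g))"
      unfolding expand[OF B A] s' t d by (simp add: sscale_add ss)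
    moreover have "sscale (dtau l A B) x = sscale (s * dtau l B A) x + sscale (contact_bracket l A B) x" for x
      unfolding sscale_add_left[symmetric] by (simp add: contact_bracket_def s_def)
    ultimately show ?thesis
      unfolding expand[OF A B] s_def[symmetric] contact_frame_0 by (simp only: ac_simps)
  qed
qed

interpretation contact: frame l n "contact_frame l" contact_weight "contact_bracket l" for l n
  by (rule frame_contact)

text \<open>Every frame field has order 1 and weight at least 1, so the doubled Heisenberg order
  bounds the usual one. This supplies the finite order that membership in
  \<open>heisenberg_ops\<close> includes.\<close>

lemma contact_ops_canonical_ops: "contact.ops l n m D \<Longrightarrow> canonical.ops l n m D"
proof (induction rule: contact.ops.induct)
  case (ident D m)
  show ?case by (rule canonical.ops.ident[OF ident.hyps])
next
  case (add m D1 D2 D)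
  show ?case by (rule canonical.ops.add[OF add.IH add.hyps(3)])
next
  case (smult h m D1 D)
  show ?case by (rule canonical.ops.smult[OF smult.hyps(1) smult.IH smult.hyps(3)])
next
  case (der A m D1 m' D)
  have m: "m + 1 \<le> m'" using der.hyps(3) by (auto simp: contact_weight_def split: if_splits)
  have 1: "canonical.ops l n m' (\<lambda>g. dq l A (D1 g))"
    by (rule canonical.ops.der[OF der.hyps(1) der.IH m refl])
  have "canonical.ops l n m' (\<lambda>g. dq l 0 (D1 g))"
    by (rule canonical.ops.der[OF le0 der.IH m refl])
  then have 2: "canonical.ops l n m' (\<lambda>g. tau l A \<odot> dq l 0 (D1 g))"
    by (rule canonical.ops.smult[OF tau_superfunctions[OF der.hyps(1)] _ refl])
  show ?case
    by (rule canonical.ops.add[OF 1 2]) (simp only: der.hyps(4) contact_frame_def)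
qed

section \<open>Contact vector fields\<close>

text \<open>The components of the contact field in the contact frame; the one along the derivative
  in \<open>z\<close> is \<open>f\<close> itself.\<close>

definition contact_coeff :: "nat \<Rightarrow> nat \<Rightarrow> nat \<Rightarrow> sfun \<Rightarrow> nat \<Rightarrow> sfun" where
  "contact_coeff l n a f s = (if s = 0 then f else
     (\<Sum>r\<in>{1..2 * l + n}. sscale (- (1/2) * (-1) ^ (a * par l r) * omega l r s) (contact_frame l r f)))"

lemma contact_coeff_closed:
  assumes "f \<in> superfunctions l n"
  shows "contact_coeff l n a f s \<in> superfunctions l n"
  unfolding contact_coeff_def using assms
  by (auto intro!: superfunctions_sum superfunctions_sscale contact_frame_closed)

lemma homogeneous_contact_frame:
  assumes "f \<in> superfunctions l n" "homogeneous a f"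
  shows "homogeneous (a + par l A) (contact_frame l A f)"
proof -
  have "homogeneous a (dq l 0 f)" using homogeneous_dq[OF assms, of 0] by (simp add: par_def)
  then have "homogeneous (par l A + a) (tau l A \<odot> dq l 0 f)" by (rule homogeneous_smult[OF homogeneous_tau])
  then show ?thesis
    unfolding contact_frame_def using homogeneous_dq[OF assms, of A]
    by (intro homogeneous_add) (simp_all add: add.commute)
qed

lemma omega_nonzero_par: "1 \<le> r \<Longrightarrow> 1 \<le> s \<Longrightarrow> omega l r s \<noteq> 0 \<Longrightarrow> par l r = par l s"
  by (auto simp: omega_def par_def split: if_splits)

lemma homogeneous_contact_coeff:
  assumes "f \<in> superfunctions l n" "homogeneous a f"
  shows "homogeneous (a + par l s) (contact_coeff l n a f s)"
proof (cases "s = 0")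
  case True
  then show ?thesis using assms(2) by (simp add: contact_coeff_def par_def)
next
  case False
  have "homogeneous (a + par l s) (sscale (- (1/2) * (-1) ^ (a * par l r) * omega l r s) (contact_frame l r f))"
    if r: "r \<in> {1..2 * l + n}" for r
  proof (cases "omega l r s = 0")
    case True
    then show ?thesis by (simp add: homogeneous_zero)
  next
    case nz: False
    have "par l r = par l s" using r False nz by (intro omega_nonzero_par) auto
    then show ?thesis
      using homogeneous_contact_frame[OF assms, of r] by (intro homogeneous_sscale) simp
  qed
  then show ?thesis
    unfolding contact_coeff_def using False by (simp only: if_False) (rule homogeneous_sum)
qed

lemma contact_field_hom_eq:
  assumes "g \<in> superfunctions l n"
  shows "contact_field_hom l n a f g = contact.vector_field l n (contact_coeff l n a f) g"
proof -
  have "{..2 * l + n} = insert 0 {1..2 * l + n}" by auto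
  then have "contact.vector_field l n (contact_coeff l n a f) g = f \<odot> dq l 0 g
      + (\<Sum>s\<in>{1..2 * l + n}. contact_coeff l n a f s \<odot> contact_frame l s g)"
    unfolding contact.vector_field_def by (simp add: contact_coeff_def contact_frame_0)
  also have "(\<Sum>s\<in>{1..2 * l + n}. contact_coeff l n a f s \<odot> contact_frame l s g)
      = (\<Sum>s\<in>{1..2 * l + n}. \<Sum>r\<in>{1..2 * l + n}.
          sscale (- (1/2)) (sscale ((-1) ^ (a * par l r) * omega l r s) (Tvf l r f \<odot> Tvf l s g)))"
    by (intro sum.cong refl)
      (simp add: contact_coeff_def smult_sum_left smult_sscale_left contact_frame_eq_Tvf mult.assoc)
  also have "\<dots> = sscale (- (1/2)) (\<Sum>r\<in>{1..2 * l + n}. \<Sum>s\<in>{1..2 * l + n}.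
          sscale ((-1) ^ (a * par l r) * omega l r s) (Tvf l r f \<odot> Tvf l s g))"
    by (subst sum.swap) (simp only: sscale_sum)
  finally show ?thesis
    unfolding contact_field_hom_def by (simp add: fun_eq_iff sscale_apply)
qed

text \<open>The matrix identity behind \<open>[X\<^sub>f, T\<^sub>A] \<in> \<langle>T\<^sub>1, \<dots>, T\<^bsub>2l+n\<^esub>\<rangle>\<close>.\<close>

lemma omega_contact_bracket:
  assumes "1 \<le> r" "r \<le> 2 * l + n" "1 \<le> A" "A \<le> 2 * l + n"
  shows "(\<Sum>B\<in>{1..2 * l + n}. omega l r B * contact_bracket l B A) = (if r = A then -2 else 0)"
proof -
  \<comment> \<open>Row \<open>r\<close> of \<open>omega\<close> has a single nonzero entry:
    \<open>e\<close>, in the column \<open>r'\<close> conjugate to \<open>r\<close>.\<close>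
  define r' where "r' = (if r \<le> l then l + r else if r \<le> 2 * l then r - l else r)"
  define e where "e = (if r \<le> l then -1 else 1 :: real)"
  have r': "r' \<in> {1..2 * l + n}" using assms by (auto simp: r'_def)
  have "omega l r B * contact_bracket l B A = (if B = r' then e * contact_bracket l r' A else 0)"
    if "1 \<le> B" for B
  proof -
    have "omega l r B = (if B = r' then e else 0)"
    proof -
      consider "r \<le> l" | "l < r" "r \<le> 2 * l" | "2 * l < r" by linarith
      then show ?thesis
        by cases (use that assms(1) in \<open>auto simp: omega_def r'_def e_def\<close>)
    qed
    then show ?thesis by simp
  qed
  then have "(\<Sum>B\<in>{1..2 * l + n}. omega l r B * contact_bracket l B A)
      = (\<Sum>B\<in>{1..2 * l + n}. if B = r' then e * contact_bracket l r' A else 0)"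
    by (intro sum.cong refl) auto
  also have "\<dots> = e * contact_bracket l r' A"
    using r' by (simp only: sum.delta finite_atLeastAtMost if_True)
  also have "\<dots> = (if r = A then -2 else 0)"
  proof -
    consider "r \<le> l" | "l < r" "r \<le> 2 * l" | "2 * l < r" by linarith
    then show ?thesis
    proof cases
      case 1
      then show ?thesis using assms(1,3)
        by (simp add: r'_def e_def contact_bracket_def dtau_def par_def) linarith
    next
      case 2
      then show ?thesis using assms(1,3)
        by (simp add: r'_def e_def contact_bracket_def dtau_def par_def) linarith
    next
      case 3
      then show ?thesis using assms(1,3)
        by (simp add: r'_def e_def contact_bracket_def dtau_def par_def) linarith
    qed
  qed
  finally show ?thesis .
qed

text \<open>The factor -1/2 of the contact field meets the -2 of
  \<open>omega_contact_bracket\<close>, and only the term \<open>r = A\<close> is left. This is the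
  contact condition in the form required by \<open>Lie_derivative_ops\<close>.\<close>

lemma contact_coeff_bracket:
  assumes "A \<le> 2 * l + n" "0 < A"
  shows "(\<Sum>B\<in>{..2 * l + n}. sscale (contact_bracket l B A) (contact_coeff l n a f B))
    = sscale ((-1) ^ (a * par l A)) (contact_frame l A (contact_coeff l n a f 0))"
proof -
  let ?N = "{1..2 * l + n}"
  define k :: "nat \<Rightarrow> real" where "k r = - (1/2) * (-1) ^ (a * par l r)" for r
  \<comment> \<open>The derivative in \<open>z\<close> supercommutes with every frame field, so the
    component \<open>f\<close> does not enter the sum.\<close>
  have b0: "contact_bracket l 0 A = 0" using assms by (auto simp: contact_bracket_def dtau_def)
  have "{..2 * l + n} = insert 0 ?N" by auto
  then have "(\<Sum>B\<in>{..2 * l + n}. sscale (contact_bracket l B A) (contact_coeff l n a f B))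
      = (\<Sum>B\<in>?N. sscale (contact_bracket l B A) (contact_coeff l n a f B))"
    by (simp add: b0)
  also have "\<dots> = (\<Sum>B\<in>?N. \<Sum>r\<in>?N. sscale (k r * (omega l r B * contact_bracket l B A)) (contact_frame l r f))"
    by (intro sum.cong refl) (simp add: contact_coeff_def sscale_sum k_def mult_ac)
  also have "\<dots> = (\<Sum>r\<in>?N. sscale (k r * (\<Sum>B\<in>?N. omega l r B * contact_bracket l B A)) (contact_frame l r f))"
  proof (subst sum.swap, rule sum.cong[OF refl])
    fix r
    have "(\<Sum>B\<in>?N. sscale (h B) y) = sscale (\<Sum>B\<in>?N. h B) y" for h y
      using sum_comp_morphism[of "\<lambda>x. sscale x y" h ?N] by (simp add: sscale_add_left o_def)
    then show "(\<Sum>B\<in>?N. sscale (k r * (omega l r B * contact_bracket l B A)) (contact_frame l r f))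
        = sscale (k r * (\<Sum>B\<in>?N. omega l r B * contact_bracket l B A)) (contact_frame l r f)"
      by (simp only: sum_distrib_left)
  qed
  also have "\<dots> = (\<Sum>r\<in>?N. if r = A then sscale ((-1) ^ (a * par l A)) (contact_frame l A f) else 0)"
  proof (rule sum.cong[OF refl])
    fix r assume "r \<in> ?N"
    then have "(\<Sum>B\<in>?N. omega l r B * contact_bracket l B A) = (if r = A then -2 else 0)"
      using assms by (intro omega_contact_bracket) auto
    then show "sscale (k r * (\<Sum>B\<in>?N. omega l r B * contact_bracket l B A)) (contact_frame l r f)
        = (if r = A then sscale ((-1) ^ (a * par l A)) (contact_frame l A f) else 0)"
      by (simp only: k_def split: if_split) simp
  qed
  also have "\<dots> = sscale ((-1) ^ (a * par l A)) (contact_frame l A f)"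
  proof -
    have "A \<in> ?N" using assms by simp
    then show ?thesis by (simp only: sum.delta finite_atLeastAtMost if_True)
  qed
  finally show ?thesis by (simp add: contact_coeff_def)
qed

text \<open>Change of components from the contact to the coordinate frame: every contact field
  carries \<open>tau l B\<close> times the derivative in \<open>z\<close>, so only the component at
  index 0 changes.\<close>

definition coordinate_coeff :: "nat \<Rightarrow> nat \<Rightarrow> (nat \<Rightarrow> sfun) \<Rightarrow> nat \<Rightarrow> sfun" where
  "coordinate_coeff l n c A = c A + (if A = 0 then \<Sum>B\<in>{..2 * l + n}. c B \<odot> tau l B else 0)"

lemma contact_vector_field_eq_canonical:
  "contact.vector_field l n c g = canonical.vector_field l n (coordinate_coeff l n c) g"
proof -
  define h where "h = (\<Sum>B\<in>{..2 * l + n}. c B \<odot> tau l B)"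
  have "canonical.vector_field l n (coordinate_coeff l n c) g
      = (\<Sum>A\<in>{..2 * l + n}. c A \<odot> dq l A g + (if A = 0 then h \<odot> dq l 0 g else 0))"
    unfolding canonical.vector_field_def coordinate_coeff_def h_def[symmetric]
    by (rule sum.cong) (auto simp: smult_add_left)
  also have "\<dots> = (\<Sum>A\<in>{..2 * l + n}. c A \<odot> dq l A g) + h \<odot> dq l 0 g"
    by (simp only: sum.distrib sum.delta finite_atMost atMost_iff le0 if_True)
  also have "\<dots> = contact.vector_field l n c g"
    unfolding contact.vector_field_def contact_frame_def h_def
    by (simp only: smult_add_right sum.distrib smult_sum_left smult_assoc)
  finally show ?thesis by simp
qed

section \<open>Parity components and the supercommutator\<close>

lemma spart_add_spart: "spart 0 f + spart 1 f = f"
  by (auto simp: spart_def fun_eq_iff)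

lemma spart_diff: "spart a (f - g) = spart a f - spart a g"
  by (auto simp: spart_def fun_eq_iff)

lemma parity_twist_1: "parity_twist 1 f = spart 0 f - spart 1 f"
  by (auto simp: spart_def parity_twist_def fun_eq_iff even_iff_mod_2_eq_zero)

lemma spart_spart: "spart a (spart b f) = (if a = b then spart b f else 0)"
  by (auto simp: spart_def fun_eq_iff)

text \<open>\<open>contact_field\<close> sums over both parities; on a homogeneous function the
  summand of the other parity is that of 0.\<close>

lemma contact_field_hom_zero: "contact_field_hom l n a 0 g = 0"
proof -
  have "dq l r 0 = 0" for r using dq_sscale[OF superfunctions_zero, of l r 0] by simp
  then have "Tvf l r 0 = 0" for r by (simp add: Tvf_def)
  then show ?thesis by (simp add: contact_field_hom_def)
qed

lemma Lie_density_eq: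
  assumes "g \<in> superfunctions l n" "a \<in> {0, 1}"
  shows "Lie_density l n mu (spart a f) g
    = contact.vector_field l n (contact_coeff l n a (spart a f)) g + sscale mu (dq l 0 (spart a f) \<odot> g)"
proof -
  have "contact_field l n (spart a f) g = contact_field_hom l n a (spart a f) g"
    using assms(2) by (auto simp: contact_field_def spart_spart contact_field_hom_zero)
  then show ?thesis by (simp only: Lie_density_def contact_field_hom_eq[OF assms(1)])
qed

lemma Lie_density_add:
  assumes "a \<in> {0, 1}" "g \<in> superfunctions l n" "h \<in> superfunctions l n"
  shows "Lie_density l n mu (spart a f) (g + h) = Lie_density l n mu (spart a f) g + Lie_density l n mu (spart a f) h"
  using assms
  by (simp only: Lie_density_eq superfunctions_add contact.vector_field_add smult_add_right sscale_add ac_simps)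

text \<open>Conjugation by the parity involution fixes even operators and negates odd ones; this
  encodes the signs against an odd contact field.\<close>

lemma opart_sum:
  assumes D: "\<And>g h. g \<in> superfunctions l n \<Longrightarrow> h \<in> superfunctions l n \<Longrightarrow> D (g + h) = D g + D h"
    and g: "g \<in> superfunctions l n"
  shows "opart 0 D g + opart 1 D g = D g"
    and "opart 0 D g - opart 1 D g = parity_twist 1 (D (parity_twist 1 g))"
proof -
  define g0 g1 where "g0 = spart 0 g" and "g1 = spart 1 g"
  have S: "g0 \<in> superfunctions l n" "g1 \<in> superfunctions l n"
    unfolding g0_def g1_def using g by (auto intro: superfunctions_spart)
  have o: "opart 0 D g = spart 0 (D g0) + spart 1 (D g1)" "opart 1 D g = spart 1 (D g0) + spart 0 (D g1)"
    by (simp_all add: opart_def g0_def g1_def)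
  have "D g = D g0 + D g1" using D[OF S] by (simp only: g0_def g1_def spart_add_spart)
  moreover have "opart 0 D g + opart 1 D g = (spart 0 (D g0) + spart 1 (D g0)) + (spart 0 (D g1) + spart 1 (D g1))"
    unfolding o by (simp only: ac_simps)
  ultimately show "opart 0 D g + opart 1 D g = D g" by (simp only: spart_add_spart)
  \<comment> \<open>Additivity is given for sums only, so the difference is reached through
    \<open>g0 = (g0 - g1) + g1\<close>.\<close>
  have "D ((g0 - g1) + g1) = D (g0 - g1) + D g1" using S by (intro D superfunctions_diff)
  then have "D (g0 - g1) = D g0 - D g1" by simp
  then have "parity_twist 1 (D (parity_twist 1 g)) = spart 0 (D g0 - D g1) - spart 1 (D g0 - D g1)"
    by (simp only: parity_twist_1 g0_def g1_def)
  then show "opart 0 D g - opart 1 D g = parity_twist 1 (D (parity_twist 1 g))"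
    unfolding o by (simp add: spart_diff)
qed

lemma opart_closed:
  assumes "\<And>g. g \<in> superfunctions l n \<Longrightarrow> D g \<in> superfunctions l n" "g \<in> superfunctions l n"
  shows "opart b D g \<in> superfunctions l n"
  unfolding opart_def by (intro superfunctions_sum superfunctions_spart assms)

text \<open>Against an even field the parts of \<open>D\<close> simply recombine; against an odd one
  their difference is the conjugate of \<open>D\<close>. The splitting of \<open>D\<close> thus
  disappears and only that of \<open>f\<close> remains.\<close>

lemma Lie_op_eq:
  assumes D: "\<And>g h. g \<in> superfunctions l n \<Longrightarrow> h \<in> superfunctions l n \<Longrightarrow> D (g + h) = D g + D h"
    and D_closed: "\<And>g. g \<in> superfunctions l n \<Longrightarrow> D g \<in> superfunctions l n"
    and L_closed: "\<And>a g. a \<in> {0, 1} \<Longrightarrow> g \<in> superfunctions l n \<Longrightarrow> Lie_density l n lam (spart a f) g \<in> superfunctions l n"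
    and g: "g \<in> superfunctions l n"
  shows "Lie_op l n lam mu f D g = (\<Sum>a\<in>{0, 1}. Lie_density l n mu (spart a f) (D g)
    - parity_twist a (D (parity_twist a (Lie_density l n lam (spart a f) g))))"
  unfolding Lie_op_def
proof (rule sum.cong[OF refl])
  fix a :: nat assume a: "a \<in> {0, 1}"
  define h where "h = Lie_density l n lam (spart a f) g"
  have h: "h \<in> superfunctions l n" unfolding h_def by (rule L_closed[OF a g])
  have "(\<Sum>b\<in>{0, 1}. Lie_density l n mu (spart a f) (opart b D g) - sscale ((- 1) ^ (a * b)) (opart b D h))
      = (Lie_density l n mu (spart a f) (opart 0 D g) + Lie_density l n mu (spart a f) (opart 1 D g))
        - (opart 0 D h + sscale ((-1) ^ a) (opart 1 D h))"
  proof -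
    have "(\<Sum>b\<in>{0, 1}. F b) = F 0 + F 1" for F :: "nat \<Rightarrow> sfun" by simp
    then show ?thesis by (simp only: add_diff_add mult_0_right power_0 sscale_one mult_1_right)
  qed
  also have "Lie_density l n mu (spart a f) (opart 0 D g) + Lie_density l n mu (spart a f) (opart 1 D g)
      = Lie_density l n mu (spart a f) (D g)"
    by (simp only: Lie_density_add[OF a opart_closed[OF D_closed g] opart_closed[OF D_closed g], symmetric]
        opart_sum(1)[OF D g])
  also have "opart 0 D h + sscale ((-1) ^ a) (opart 1 D h) = parity_twist a (D (parity_twist a h))"
  proof (cases "a = 0")
    case True
    then show ?thesis by (simp only: power_0 sscale_one parity_twist_0 opart_sum(1)[OF D h])
  next
    case False
    then have "a = 1" using a by simp
    then show ?thesis
      by (simp only: power_one_right sscale_minus_one add_uminus_conv_diff opart_sum(2)[OF D h])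
  qed
  finally show "(\<Sum>b\<in>{0, 1}. Lie_density l n mu (spart a f) (opart b D g) - sscale ((- 1) ^ (a * b)) (opart b D h))
      = Lie_density l n mu (spart a f) (D g) - parity_twist a (D (parity_twist a h))" .
qed

section \<open>The two filtrations\<close>

text \<open>With all weights equal to 1, \<open>index_weight\<close> is the total order, and the
  normal form is the definition of \<open>diff_ops\<close> itself.\<close>

lemma diff_ops_eq: "diff_ops l n k = {D. canonical.ops l n k D}"
  unfolding diff_ops_def canonical.ops_iff_normal_form canonical.normal_form_def canonical.indices_def
    canonical.index_weight_def canonical.monomial_def dq_power_def
  by simp

text \<open>In a Heisenberg expansion slot 0 of the multi-index is kept free, so it can store the
  exponent \<open>c\<close>.\<close>

lemma contact_monomial:
  "contact.monomial l n (K(0 := c)) g = (dq l 0 ^^ c) (T_power l n K g)"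
proof -
  have upt: "[0..<2 * l + n + 1] = 0 # [1..<2 * l + n + 1]"
    unfolding One_nat_def by (rule upt_conv_Cons) simp
  have "foldr (\<lambda>A h. (contact_frame l A ^^ (K(0 := c)) A) \<circ> h) [1..<2 * l + n + 1] id
      = foldr (\<lambda>r h. (Tvf l r ^^ K r) \<circ> h) [1..<2 * l + n + 1] id"
  proof (rule foldr_cong[OF refl refl])
    fix A h assume "A \<in> set [1..<2 * l + n + 1]"
    then have "0 < A" by auto
    then have "contact_frame l A = Tvf l A" by (intro ext contact_frame_eq_Tvf)
    then show "(contact_frame l A ^^ (K(0 := c)) A) \<circ> h = (Tvf l A ^^ K A) \<circ> h" using \<open>0 < A\<close> by simp
  qed
  then show ?thesis
    unfolding contact.monomial_def upt T_power_def by (simp add: contact_frame_0)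
qed

lemma contact_index_weight:
  "contact.index_weight l n (K(0 := c)) = 2 * c + (\<Sum>r\<in>{1..2 * l + n}. K r)"
proof -
  have "{0..2 * l + n} = insert 0 {1..2 * l + n}" by auto
  then have "contact.index_weight l n (K(0 := c))
      = 2 * c + (\<Sum>A\<in>{1..2 * l + n}. contact_weight A * (K(0 := c)) A)"
    unfolding contact.index_weight_def by (simp add: contact_weight_def)
  also have "(\<Sum>A\<in>{1..2 * l + n}. contact_weight A * (K(0 := c)) A) = (\<Sum>r\<in>{1..2 * l + n}. K r)"
    by (rule sum.cong) (auto simp: contact_weight_def)
  finally show ?thesis .
qed

lemma multi_indices_fun_upd_0: "K(0 := c) \<in> multi_indices l n \<longleftrightarrow> K \<in> multi_indices l n"
  by (auto simp: multi_indices_def)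

lemma contact_ops_heisenberg_expansion:
  assumes "contact.ops l n m D"
  shows "\<exists>E. heisenberg_expansion l n D E \<and>
    (\<forall>c K. E c K \<noteq> 0 \<longrightarrow> 2 * c + (\<Sum>r\<in>{1..2 * l + n}. K r) \<le> m)"
proof -
  obtain C where C: "\<And>I. C I \<in> superfunctions l n"
      "\<And>g. g \<in> superfunctions l n \<Longrightarrow> D g = (\<Sum>I\<in>contact.indices l n m. C I \<odot> contact.monomial l n I g)"
    using assms unfolding contact.ops_iff_normal_form contact.normal_form_def by blast
  \<comment> \<open>The condition \<open>K 0 = 0\<close> picks one representative: indices that
    differ only in slot 0 share \<open>K(0 := c)\<close> and would count the same coefficient
    repeatedly.\<close>
  define E where "E c K = (if K 0 = 0 \<and> K(0 := c) \<in> contact.indices l n m then C (K(0 := c)) else 0)" for c K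
  define split where "split I = (I 0, I(0 := 0))" for I :: "nat \<Rightarrow> nat"
  have E: "K 0 = 0" "K \<in> multi_indices l n" "2 * c + (\<Sum>r\<in>{1..2 * l + n}. K r) \<le> m"
      "(c, K) \<in> split ` contact.indices l n m" if "E c K \<noteq> 0" for c K
  proof -
    have K: "K 0 = 0" "K(0 := c) \<in> contact.indices l n m"
      using that by (auto simp: E_def split: if_splits)
    then show "K 0 = 0" "K \<in> multi_indices l n" "2 * c + (\<Sum>r\<in>{1..2 * l + n}. K r) \<le> m"
      unfolding contact.indices_def by (simp_all add: multi_indices_fun_upd_0 contact_index_weight)
    have "split (K(0 := c)) = (c, K)" using K(1) by (simp add: split_def fun_upd_idem)
    then show "(c, K) \<in> split ` contact.indices l n m" using K(2) by (metis image_eqI)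
  qed
  have fin: "finite (split ` contact.indices l n m)" by (intro finite_imageI contact.finite_indices)
  have sub: "{(c, K). E c K \<noteq> 0} \<subseteq> split ` contact.indices l n m" using E(4) by auto
  have inj: "inj_on split (contact.indices l n m)"
  proof (rule inj_onI, rule ext)
    fix I J x assume "split I = split J"
    then have 0: "I 0 = J 0" and upd: "I(0 := 0) = J(0 := 0)" by (simp_all add: split_def)
    show "I x = J x" using 0 fun_cong[OF upd, of x] by (cases "x = 0") auto
  qed
  have D: "D g = (\<Sum>(c, K)\<in>{(c, K). E c K \<noteq> 0}. E c K \<odot> (dq l 0 ^^ c) (T_power l n K g))"
    if g: "g \<in> superfunctions l n" for g
  proof -
    \<comment> \<open>Some \<open>C I\<close> may vanish, so the image of all indices can exceed the
      support; the extra terms are 0.\<close>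
    have "(\<Sum>(c, K)\<in>{(c, K). E c K \<noteq> 0}. E c K \<odot> (dq l 0 ^^ c) (T_power l n K g))
        = (\<Sum>(c, K)\<in>split ` contact.indices l n m. E c K \<odot> (dq l 0 ^^ c) (T_power l n K g))"
      by (rule sum.mono_neutral_left[OF fin sub]) auto
    also have "\<dots> = (\<Sum>I\<in>contact.indices l n m. C I \<odot> contact.monomial l n I g)"
    proof (subst sum.reindex[OF inj], rule sum.cong[OF refl])
      fix I assume "I \<in> contact.indices l n m"
      then show "((\<lambda>(c, K). E c K \<odot> (dq l 0 ^^ c) (T_power l n K g)) \<circ> split) I = C I \<odot> contact.monomial l n I g"
        using contact_monomial[of l n "I(0 := 0)" "I 0" g] by (simp add: split_def E_def)
    qed
    finally show ?thesis using C(2)[OF g] by simp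
  qed
  have "heisenberg_expansion l n D E"
    unfolding heisenberg_expansion_def
  proof (intro conjI allI impI ballI finite_subset[OF sub fin] D)
    show "E c K \<in> superfunctions l n" for c K by (simp add: E_def C(1) superfunctions_zero)
  qed (use E in auto)
  then show ?thesis using E(3) by blast
qed

lemma heisenberg_expansion_contact_ops:
  assumes E: "heisenberg_expansion l n D E"
    and bound: "\<And>c K. E c K \<noteq> 0 \<Longrightarrow> 2 * c + (\<Sum>r\<in>{1..2 * l + n}. K r) \<le> m"
  shows "contact.ops l n m D"
proof -
  note E' = E[unfolded heisenberg_expansion_def]
  note C = E'[THEN conjunct1, rule_format]
  note supp = E'[THEN conjunct2, THEN conjunct1, rule_format]
  note fin = E'[THEN conjunct2, THEN conjunct2, THEN conjunct1]
  note D = E'[THEN conjunct2, THEN conjunct2, THEN conjunct2, THEN bspec]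
  have "contact.ops l n m (\<lambda>g. \<Sum>x\<in>{(c, K). E c K \<noteq> 0}.
      case x of (c, K) \<Rightarrow> E c K \<odot> (dq l 0 ^^ c) (T_power l n K g))"
  proof (rule contact.ops_sum[OF fin])
    fix x assume "x \<in> {(c, K). E c K \<noteq> 0}"
    then obtain c K where x: "x = (c, K)" and nz: "E c K \<noteq> 0" by auto
    have "K(0 := c) \<in> contact.indices l n m"
      using supp[OF nz] bound[OF nz] by (simp add: contact.indices_def multi_indices_fun_upd_0 contact_index_weight)
    then have "contact.ops l n m (contact.monomial l n (K(0 := c)))"
      unfolding contact.ops_iff_normal_form by (rule contact.normal_form_monomial)
    then have "contact.ops l n m (\<lambda>g. E c K \<odot> contact.monomial l n (K(0 := c)) g)"
      by (rule contact.ops.smult[OF C _ refl])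
    then show "contact.ops l n m (\<lambda>g. case x of (c, K) \<Rightarrow> E c K \<odot> (dq l 0 ^^ c) (T_power l n K g))"
      by (simp only: x prod.case contact_monomial)
  qed
  then show ?thesis by (rule contact.ops_cong) (rule D)
qed

lemma heisenberg_ops_eq:
  assumes "real m = 2 * d"
  shows "heisenberg_ops l n d = {D. contact.ops l n m D}"
proof -
  have le: "real c + real (\<Sum>r\<in>{1..2 * l + n}. K r) / 2 \<le> d \<longleftrightarrow> 2 * c + (\<Sum>r\<in>{1..2 * l + n}. K r) \<le> m" for c K
  proof -
    have "real c + real (\<Sum>r\<in>{1..2 * l + n}. K r) / 2 \<le> d
        \<longleftrightarrow> real (2 * c + (\<Sum>r\<in>{1..2 * l + n}. K r)) \<le> real m"
      unfolding assms of_nat_add by (simp only: of_nat_mult of_nat_numeral) linarith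
    then show ?thesis by (simp only: of_nat_le_iff)
  qed
  show ?thesis
  proof (intro set_eqI iffI CollectI)
    fix D assume "D \<in> heisenberg_ops l n d"
    then obtain E where "heisenberg_expansion l n D E"
        "\<And>c K. E c K \<noteq> 0 \<Longrightarrow> 2 * c + (\<Sum>r\<in>{1..2 * l + n}. K r) \<le> m"
      unfolding heisenberg_ops_def le by blast
    then show "contact.ops l n m D" by (rule heisenberg_expansion_contact_ops)
  next
    fix D assume "D \<in> {D. contact.ops l n m D}"
    then have D: "contact.ops l n m D" by simp
    have "D \<in> diff_ops l n m" using contact_ops_canonical_ops[OF D] by (simp add: diff_ops_eq)
    then show "D \<in> heisenberg_ops l n d"
      using contact_ops_heisenberg_expansion[OF D] unfolding heisenberg_ops_def le by blast
  qed
qed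

section \<open>Invariance under the contact action\<close>

lemma contact_data:
  assumes "f \<in> superfunctions l n" "a \<in> {0, 1}"
  defines "h \<equiv> spart a f"
  shows "h \<in> superfunctions l n" "homogeneous a h"
    and "dq l 0 h \<in> superfunctions l n" "homogeneous a (dq l 0 h)"
proof -
  show h: "h \<in> superfunctions l n" "homogeneous a h"
    unfolding h_def using assms by (auto intro: superfunctions_spart homogeneous_spart)
  show "dq l 0 h \<in> superfunctions l n" using h(1) by (rule superfunctions_dq)
  show "homogeneous a (dq l 0 h)" using homogeneous_dq[OF h, of 0] by (simp add: par_def)
qed

lemma Lie_density_closed:
  assumes "f \<in> superfunctions l n" "a \<in> {0, 1}" "g \<in> superfunctions l n"
  shows "Lie_density l n mu (spart a f) g \<in> superfunctions l n"
  unfolding Lie_density_eq[OF assms(3,2)] using contact_data[OF assms(1,2)] assms(3)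
  by (intro superfunctions_add contact.vector_field_closed contact_coeff_closed superfunctions_sscale superfunctions_smult)

lemma contact_ops_Lie_op:
  assumes f: "f \<in> superfunctions l n" and D: "contact.ops l n m D"
  shows "contact.ops l n m (Lie_op l n lam mu f D)"
proof -
  have "contact.ops l n m (\<lambda>g. Lie_density l n mu (spart a f) (D g)
      - parity_twist a (D (parity_twist a (Lie_density l n lam (spart a f) g))))" if a: "a \<in> {0, 1}" for a
  proof (rule contact.Lie_derivative_ops[OF _ _ contact_data(3,4)[OF f a] Lie_density_eq[OF _ a] _ D])
    fix A assume A: "A \<le> 2 * l + n"
    show "contact_coeff l n a (spart a f) A \<in> superfunctions l n"
      by (rule contact_coeff_closed[OF contact_data(1)[OF f a]])
    show "homogeneous (a + par l A) (contact_coeff l n a (spart a f) A)"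
      by (rule homogeneous_contact_coeff[OF contact_data(1,2)[OF f a]])
    \<comment> \<open>Only the fields of positive index weigh less than the derivative in
      \<open>z\<close>, so the contact condition is called for exactly there.\<close>
    assume "contact_weight A < contact_weight 0"
    then have "0 < A" by (simp add: contact_weight_def split: if_splits)
    then show "(\<Sum>B\<in>{..2 * l + n}. sscale (contact_bracket l B A) (contact_coeff l n a (spart a f) B))
        = sscale ((-1) ^ (a * par l A)) (contact_frame l A (contact_coeff l n a (spart a f) 0))"
      by (rule contact_coeff_bracket[OF A])
  qed
  then have "contact.ops l n m (\<lambda>g. \<Sum>a\<in>{0, 1}. Lie_density l n mu (spart a f) (D g)
      - parity_twist a (D (parity_twist a (Lie_density l n lam (spart a f) g))))"
    by (intro contact.ops_sum) auto
  then show ?thesis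
    by (rule contact.ops_cong)
      (rule Lie_op_eq[OF contact.ops_additive[OF D] contact.ops_closed[OF D] Lie_density_closed[OF f]])
qed

lemma canonical_ops_Lie_op:
  assumes f: "f \<in> superfunctions l n" and D: "canonical.ops l n k D"
  shows "canonical.ops l n k (Lie_op l n lam mu f D)"
proof -
  have "canonical.ops l n k (\<lambda>g. Lie_density l n mu (spart a f) (D g)
      - parity_twist a (D (parity_twist a (Lie_density l n lam (spart a f) g))))" if a: "a \<in> {0, 1}" for a
  proof -
    let ?c = "contact_coeff l n a (spart a f)"
    note h = contact_data[OF f a]
    have c: "?c A \<in> superfunctions l n" "homogeneous (a + par l A) (?c A)" for A
      using h by (auto intro: contact_coeff_closed homogeneous_contact_coeff)
    show ?thesis
    proof (rule canonical.Lie_derivative_ops[OF _ _ h(3,4) _ _ D])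
      fix A assume A: "A \<le> 2 * l + n"
      show "coordinate_coeff l n ?c A \<in> superfunctions l n"
      proof -
        have "(\<Sum>B\<in>{..2 * l + n}. ?c B \<odot> tau l B) \<in> superfunctions l n"
          by (rule superfunctions_sum) (simp add: superfunctions_smult c(1) tau_superfunctions)
        then show ?thesis
          by (simp add: coordinate_coeff_def superfunctions_add c(1) superfunctions_zero)
      qed
      show "homogeneous (a + par l A) (coordinate_coeff l n ?c A)"
      proof -
        have "homogeneous (a + par l B + par l B) (?c B \<odot> tau l B)" for B
          by (rule homogeneous_smult[OF c(2) homogeneous_tau])
        moreover have "even (a + par l B + par l B) = even a" for B by auto
        ultimately have "homogeneous a (?c B \<odot> tau l B)" for B using homogeneous_cong by blast
        then have "homogeneous a (\<Sum>B\<in>{..2 * l + n}. ?c B \<odot> tau l B)" by (rule homogeneous_sum)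
        then have "homogeneous (a + par l 0) (?c 0 + (\<Sum>B\<in>{..2 * l + n}. ?c B \<odot> tau l B))"
          by (intro homogeneous_add c(2)) (simp add: par_def)
        then show ?thesis
          by (cases "A = 0") (simp_all add: coordinate_coeff_def c(2))
      qed
    next
      fix mu g assume "g \<in> superfunctions l n"
      then show "Lie_density l n mu (spart a f) g
          = canonical.vector_field l n (coordinate_coeff l n ?c) g + sscale mu (dq l 0 (spart a f) \<odot> g)"
        by (simp only: Lie_density_eq[OF _ a] contact_vector_field_eq_canonical)
    \<comment> \<open>The remaining condition concerns fields lighter than the one with index 0, and
      all weights are equal here.\<close>
    qed simp
  qed
  then have "canonical.ops l n k (\<lambda>g. \<Sum>a\<in>{0, 1}. Lie_density l n mu (spart a f) (D g)
      - parity_twist a (D (parity_twist a (Lie_density l n lam (spart a f) g))))"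
    by (intro canonical.ops_sum) auto
  then show ?thesis
    by (rule canonical.ops_cong)
      (rule Lie_op_eq[OF canonical.ops_additive[OF D] canonical.ops_closed[OF D] Lie_density_closed[OF f]])
qed

theorem proposition7p3:
  fixes l n k :: nat and lam mu d :: real and f :: sfun
  assumes "f \<in> superfunctions l n" and "2 * d \<in> \<nat>"
  shows "Lie_op l n lam mu f ` diff_ops l n k \<subseteq> diff_ops l n k \<and>
         Lie_op l n lam mu f ` heisenberg_ops l n d \<subseteq> heisenberg_ops l n d \<and>
         Lie_op l n lam mu f ` bifiltered_ops l n k d \<subseteq> bifiltered_ops l n k d"
proof -
  \<comment> \<open>Degree \<open>m\<close> in the contact frame is Heisenberg order
    \<open>m / 2\<close>.\<close>
  obtain m where m: "real m = 2 * d" using assms(2) by (metis Nats_cases)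
  have "Lie_op l n lam mu f ` diff_ops l n k \<subseteq> diff_ops l n k"
    using canonical_ops_Lie_op[OF assms(1)] by (auto simp: diff_ops_eq)
  moreover have "Lie_op l n lam mu f ` heisenberg_ops l n d \<subseteq> heisenberg_ops l n d"
    using contact_ops_Lie_op[OF assms(1)] by (auto simp: heisenberg_ops_eq[OF m])
  ultimately show ?thesis by (auto simp: bifiltered_ops_def)
qed

end
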